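(* In the dynamical system $(T,[0,1],\lambda)$, where $T$ is the von Neumann–Kakutani map and $\mu=\lambda$ is the Lebesgue measure on $[0,1]$: $$D^{\pm}_\tau(q)=\begin{cases}1 & \text{for } q\le2,\\ \dfrac{1}{q-1} & \text{for } q>2.\end{cases}$$ Moreover, for all grids $\theta$, $$\Delta^+_\tau(\theta,q)=\Delta^+_\mu(\theta,q)=\infty\quad\text{for } q<0.$$ Finally, there are infinitely many grids $\theta$ for which $$\Delta^+_\tau(\theta,q)=1\ \text{ for } q\ge0,\qquad\text{and}\qquad \Delta^-_\tau(\theta,q)=1\ \text{ for } q\le0.$$
   Context: The von Neumann–Kakutani map $T:[0,1]\to[0,1]$: for $k=0,1,\dots$ let $J_k=[1-2^{-k},1-2^{-k-1})$; then $T(x)=x-1+2^{-k}+2^{-k-1}$ for $x\in J_k$, and $T(1)=0$. It preserves Lebesgue measure $\lambda$. Set $X=[0,1]$, $\mu=\lambda$. $B_\varepsilon(x)$ is the ball (in $X$) of radius $\varepsilon$ centered at $x$. For measurable $A$ and $x\in A$, $\tau_A(x)=\inf\{m>0:\ T^m(x)\in A\}$ is the first return time. Return time generalized dimensions: for $q\ne1$ let $\Gamma_\tau(\varepsilon,q)=\int_X[\tau_{B_\varepsilon(x)}(x)]^{1-q}d\mu(x)$, and let $\Gamma^l_\tau(\varepsilon)=\int_X\log[\tau^{-1}_{B_\varepsilon(x)}(x)]d\mu(x)$. For $q\ne1$, $D^+_\tau(q)$ and $D^-_\tau(q)$ are the limsup and liminf, as $\varepsilon\to0$, of $\frac{1}{q-1}\frac{\log\Gamma_\tau(\varepsilon,q)}{\log\varepsilon}$;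 for $q=1$ they are the limsup and liminf of $\Gamma^l_\tau(\varepsilon)/\log\varepsilon$. Grids and box dimensions: a grid $\theta$ is a choice of origin and orientation in $\mathbb{R}$ (the same for all $\varepsilon$); for each $\varepsilon>0$ it determines the partition of the line into (half-open) intervals $A_j$ of length $\varepsilon$ having the origin of $\theta$ as an endpoint of one of them (intersected with $X$). For $q\neq1$ let $\Upsilon_\mu(\theta,\varepsilon,q)=\sum_{j:\mu(A_j)>0}\mu(A_j)^q$ and $\Upsilon_\tau(\theta,\varepsilon,q)=\sum_j\int_{A_j}\tau_{A_j}^{1-q}(x)\,d\mu(x)$; let $\Upsilon^l_\mu(\theta,\varepsilon)=\sum_{j:\mu(A_j)>0}\mu(A_j)\log[\mu(A_j)]$ and $\Upsilon^l_\tau(\theta,\varepsilon)=\sum_j\int_{A_j}\log[\tau_{A_j}^{-1}(x)]\,d\mu(x)$. For $\sigma\in\{\mu,\tau\}$ and $q\ne1$, $\Delta^+_\sigma(\theta,q)$ and $\Delta^-_\sigma(\theta,q)$ are the limsup and liminf, as $\varepsilon\to0$, of $\frac{1}{q-1}\frac{\log\Upsilon_\sigma(\theta,\varepsilon,q)}{\log\varepsilon}$; for $q=1$ they are the limsup and liminf of $\Upsilon^l_\sigma(\theta,\varepsilon)/\log\varepsilon$. A partition function whose integrand is not summable has value $+\infty$, and then the corresponding dimension is $+\infty$. *)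

theory Defs
  imports "HOL-Analysis.Analysis"
begin

definition vnk_piece :: "nat \<Rightarrow> real set" where
  "vnk_piece k = {1 - 1 / 2 ^ k ..< 1 - 1 / 2 ^ (k + 1)}"

text \<open>The von Neumann--Kakutani map. The pieces partition \<open>[0,1)\<close>; the point \<open>1\<close> goes to \<open>0\<close>.
  Points outside \<open>[0,1]\<close> are irrelevant and are sent to \<open>0\<close> as well.\<close>

definition vnk :: "real \<Rightarrow> real" where
  "vnk x = (if \<exists>k. x \<in> vnk_piece k
            then (let k = (THE k. x \<in> vnk_piece k) in x - 1 + 1 / 2 ^ k + 1 / 2 ^ (k + 1))
            else 0)"

lemma vnk_piece_unique:
  assumes "x \<in> vnk_piece k" "x \<in> vnk_piece l"
  shows "k = l"
proof -
  have le: "m \<le> n" if "x \<in> vnk_piece m" "x \<in> vnk_piece n" for m n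
  proof (rule ccontr)
    assume "\<not> m \<le> n"
    then have "(2::real) ^ (n + 1) \<le> 2 ^ m"
      by (intro power_increasing) auto
    then have "1 / (2::real) ^ m \<le> 1 / 2 ^ (n + 1)"
      by (intro divide_left_mono) auto
    with that show False
      by (auto simp: vnk_piece_def)
  qed
  from le[of k l] le[of l k] assms show ?thesis by simp
qed

lemma vnk_eq:
  assumes "x \<in> vnk_piece k"
  shows "vnk x = x - 1 + 1 / 2 ^ k + 1 / 2 ^ (k + 1)"
proof -
  have "(THE k. x \<in> vnk_piece k) = k"
    using assms vnk_piece_unique by blast
  with assms show ?thesis
    unfolding vnk_def Let_def by auto
qed

lemma vnk_1: "vnk 1 = 0"
  by (auto simp: vnk_def vnk_piece_def)

definition unit_lebesgue :: "real measure" where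
  "unit_lebesgue = restrict_space lborel {0..1}"

text \<open>The infimum of the empty set is \<open>\<infinity>\<close>, the return time of a point that never comes back.\<close>

definition return_time :: "(real \<Rightarrow> real) \<Rightarrow> real set \<Rightarrow> real \<Rightarrow> enat" where
  "return_time T A x = (INF m\<in>{m. m > 0 \<and> (T ^^ m) x \<in> A}. enat m)"

definition eln :: "ennreal \<Rightarrow> ereal" where
  "eln z = (if z = 0 then -\<infinity> else if z = \<infinity> then \<infinity> else ereal (ln (enn2real z)))"

text \<open>Powers of extended numbers; used only for strictly positive bases.\<close>

definition epowr :: "ennreal \<Rightarrow> real \<Rightarrow> ennreal" where
  "epowr z a = (if z = \<infinity> then (if a > 0 then \<infinity> else if a = 0 then 1 else 0)
                else ennreal (enn2real z powr a))"

definition return_pow :: "(real \<Rightarrow> real) \<Rightarrow> real \<Rightarrow> real set \<Rightarrow> real \<Rightarrow> ennreal" where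
  "return_pow T q A x = epowr (ennreal_of_enat (return_time T A x)) (1 - q)"

text \<open>Return times are at least \<open>1\<close>, so their logarithm is nonnegative and the conversion to
  \<^typ>\<open>ennreal\<close> loses nothing.\<close>

definition return_log :: "(real \<Rightarrow> real) \<Rightarrow> real set \<Rightarrow> real \<Rightarrow> ennreal" where
  "return_log T A x = e2ennreal (eln (ennreal_of_enat (return_time T A x)))"

definition Gamma_tau :: "real measure \<Rightarrow> (real \<Rightarrow> real) \<Rightarrow> real \<Rightarrow> real \<Rightarrow> ennreal" where
  "Gamma_tau M T \<epsilon> q = (\<integral>\<^sup>+ x. return_pow T q (ball x \<epsilon> \<inter> space M) x \<partial>M)"

text \<open>The integral of \<open>log (1 / \<tau>)\<close> is minus the integral of the nonnegative function \<open>log \<tau>\<close>;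
  it is \<open>-\<infinity>\<close> if the latter is not integrable, and division by \<open>ln \<epsilon> < 0\<close> then gives \<open>+\<infinity>\<close>.\<close>

definition Gamma_tau_log :: "real measure \<Rightarrow> (real \<Rightarrow> real) \<Rightarrow> real \<Rightarrow> ereal" where
  "Gamma_tau_log M T \<epsilon> = - enn2ereal (\<integral>\<^sup>+ x. return_log T (ball x \<epsilon> \<inter> space M) x \<partial>M)"

text \<open>The orientation of a grid decides which endpoint of each half-open cell is included.\<close>

datatype orientation = Rightward | Leftward

type_synonym grid = "real \<times> orientation"

fun grid_cell :: "grid \<Rightarrow> real \<Rightarrow> int \<Rightarrow> real set" where
  "grid_cell (a, Rightward) \<epsilon> j = {a + of_int j * \<epsilon> ..< a + (of_int j + 1) * \<epsilon>}"
| "grid_cell (a, Leftward) \<epsilon> j = {a - (of_int j + 1) * \<epsilon> <.. a - of_int j * \<epsilon>}"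

definition cell_in :: "real measure \<Rightarrow> grid \<Rightarrow> real \<Rightarrow> int \<Rightarrow> real set" where
  "cell_in M \<theta> \<epsilon> j = grid_cell \<theta> \<epsilon> j \<inter> space M"

definition Upsilon_mu :: "real measure \<Rightarrow> grid \<Rightarrow> real \<Rightarrow> real \<Rightarrow> ennreal" where
  "Upsilon_mu M \<theta> \<epsilon> q =
     (\<Sum>\<^sub>\<infinity>j\<in>{j. emeasure M (cell_in M \<theta> \<epsilon> j) > 0}. epowr (emeasure M (cell_in M \<theta> \<epsilon> j)) q)"

definition Upsilon_mu_log :: "real measure \<Rightarrow> grid \<Rightarrow> real \<Rightarrow> ereal" where
  "Upsilon_mu_log M \<theta> \<epsilon> =
     (\<Sum>\<^sub>\<infinity>j\<in>{j. emeasure M (cell_in M \<theta> \<epsilon> j) > 0}.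
        enn2ereal (emeasure M (cell_in M \<theta> \<epsilon> j)) * eln (emeasure M (cell_in M \<theta> \<epsilon> j)))"

definition Upsilon_tau ::
  "real measure \<Rightarrow> (real \<Rightarrow> real) \<Rightarrow> grid \<Rightarrow> real \<Rightarrow> real \<Rightarrow> ennreal" where
  "Upsilon_tau M T \<theta> \<epsilon> q =
     (\<Sum>\<^sub>\<infinity>j. \<integral>\<^sup>+ x \<in> cell_in M \<theta> \<epsilon> j. return_pow T q (cell_in M \<theta> \<epsilon> j) x \<partial>M)"

definition Upsilon_tau_log :: "real measure \<Rightarrow> (real \<Rightarrow> real) \<Rightarrow> grid \<Rightarrow> real \<Rightarrow> ereal" where
  "Upsilon_tau_log M T \<theta> \<epsilon> =
     - enn2ereal (\<Sum>\<^sub>\<infinity>j. \<integral>\<^sup>+ x \<in> cell_in M \<theta> \<epsilon> j. return_log T (cell_in M \<theta> \<epsilon> j) x \<partial>M)"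

text \<open>The quotient whose upper and lower limits as \<open>\<epsilon> \<rightarrow> 0\<close> are the generalized dimensions, for a
  partition function \<open>Z \<epsilon> q\<close> with logarithmic counterpart \<open>L \<epsilon>\<close> at \<open>q = 1\<close>.\<close>

definition dim_quotient ::
  "(real \<Rightarrow> real \<Rightarrow> ennreal) \<Rightarrow> (real \<Rightarrow> ereal) \<Rightarrow> real \<Rightarrow> real \<Rightarrow> ereal" where
  "dim_quotient Z L q \<epsilon> =
     (if q = 1 then L \<epsilon> / ereal (ln \<epsilon>)
      else ereal (1 / (q - 1)) * (eln (Z \<epsilon> q) / ereal (ln \<epsilon>)))"

definition upper_dim :: "(real \<Rightarrow> real \<Rightarrow> ennreal) \<Rightarrow> (real \<Rightarrow> ereal) \<Rightarrow> real \<Rightarrow> ereal" where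
  "upper_dim Z L q = Limsup (at_right 0) (dim_quotient Z L q)"

definition lower_dim :: "(real \<Rightarrow> real \<Rightarrow> ennreal) \<Rightarrow> (real \<Rightarrow> ereal) \<Rightarrow> real \<Rightarrow> ereal" where
  "lower_dim Z L q = Liminf (at_right 0) (dim_quotient Z L q)"

definition D_tau_upper :: "real measure \<Rightarrow> (real \<Rightarrow> real) \<Rightarrow> real \<Rightarrow> ereal" where
  "D_tau_upper M T = upper_dim (Gamma_tau M T) (Gamma_tau_log M T)"

definition D_tau_lower :: "real measure \<Rightarrow> (real \<Rightarrow> real) \<Rightarrow> real \<Rightarrow> ereal" where
  "D_tau_lower M T = lower_dim (Gamma_tau M T) (Gamma_tau_log M T)"

definition Delta_mu_upper :: "real measure \<Rightarrow> grid \<Rightarrow> real \<Rightarrow> ereal" where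
  "Delta_mu_upper M \<theta> = upper_dim (Upsilon_mu M \<theta>) (Upsilon_mu_log M \<theta>)"

definition Delta_tau_upper :: "real measure \<Rightarrow> (real \<Rightarrow> real) \<Rightarrow> grid \<Rightarrow> real \<Rightarrow> ereal" where
  "Delta_tau_upper M T \<theta> = upper_dim (Upsilon_tau M T \<theta>) (Upsilon_tau_log M T \<theta>)"

definition Delta_tau_lower :: "real measure \<Rightarrow> (real \<Rightarrow> real) \<Rightarrow> grid \<Rightarrow> real \<Rightarrow> ereal" where
  "Delta_tau_lower M T \<theta> = lower_dim (Upsilon_tau M T \<theta>) (Upsilon_tau_log M T \<theta>)"

end

theory Submission
  imports Defs "HOL-Real_Asymp.Real_Asymp"
begin

text \<open>On binary expansions read backwards the von Neumann--Kakutani map is addition of \<open>1\<close>. Hence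
  \<open>T^m x\<close> lies in the dyadic cell of order \<open>n\<close> of \<open>x\<close> iff \<open>2^n\<close> divides \<open>m\<close>. For balls this bounds
  the return time by \<open>2 / \<epsilon>\<close>, and shows that it is at least \<open>2^n\<close> away from the \<open>\<epsilon>\<close>-neighbourhoods of
  the \<open>2^n - 1\<close> dyadic endpoints of order \<open>n\<close>; integrating gives \<open>D(q) = 1\<close> for \<open>q \<le> 2\<close>. For
  \<open>q > 2\<close> the integral is dominated by the points within \<open>\<epsilon> / 3\<close> to the left of \<open>1/2\<close>, which return
  after three steps.

  For a grid, Kac's formula makes the integral of the return time over each of the \<open>N\<close> cells of
  positive measure equal to \<open>1\<close>, and Jensen's inequality compares the partition function with
  \<open>N powr (1 - q)\<close>, where \<open>N\<close> is between \<open>1 / \<epsilon>\<close> and \<open>3 / \<epsilon>\<close>. If the origin is an integer and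
  \<open>\<epsilon> = 2^-n\<close>, all return times equal \<open>2^n\<close>, which attains the bound. For \<open>q < 0\<close> a grid can be
  scaled so that it cuts off an exponentially small cell at one end of the unit interval.\<close>

section \<open>The map as an odometer\<close>

text \<open>The threshold \<open>q = 2\<close> comes from comparing scales. Around the dyadic
  endpoints of order i + 1 lies a set of measure about 2^i \<epsilon> whose points may return after
  2^i steps; it contributes at most about \<epsilon> 2^(i (2 - q)). For 1 < q < 2 the finest scale
  2^i ~ 1/\<epsilon> wins and gives the order \<epsilon>^(q - 1); at q = 2 all scales weigh the
  same, which costs only a logarithm; for q > 2 the bound \<epsilon> log (1/\<epsilon>) inherited
  from q = 2 is already sharp enough, and \<epsilon> against the normalisation (q - 1) log
  \<epsilon> yields 1/(q - 1). For grids, Jensen's inequality is used as a tangent line, because the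
  integral of an affine function of the return time is known exactly from Kac's formula. The
  function t^(1 - q) is convex for q \<le> 0 and for q \<ge> 1 and concave in between, while
  division by (q - 1) log \<epsilon> reverses inequalities at q = 1 only. So the quotient is bounded
  above for q \<ge> 0 and below for q \<le> 0, which is why the statements on upper and lower
  dimensions are split at 0.\<close>

lemma vnk_piece_exists:
  assumes "0 \<le> x" "x < 1"
  obtains k where "x \<in> vnk_piece k"
proof -
  let ?P = "\<lambda>k. x < 1 - 1 / 2 ^ (k + 1)"
  obtain n where "(1/2) ^ n < 1 - x"
    using assms(2) real_arch_pow_inv[of "1 - x" "1/2"] by auto
  then have "?P n"
    by (simp add: field_simps)
  define k where "k = (LEAST k. ?P k)"
  have "?P k" unfolding k_def using \<open>?P n\<close> by (rule LeastI)
  moreover have "1 - 1 / 2 ^ k \<le> x"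
  proof (cases k)
    case (Suc m)
    then have "\<not> ?P m" using not_less_Least[of m ?P] unfolding k_def by simp
    then show ?thesis using Suc by simp
  qed (use assms in simp)
  ultimately show ?thesis using that[of k] by (auto simp: vnk_piece_def)
qed

lemma vnk_bounds_piece:
  assumes "x \<in> vnk_piece k"
  shows "1 / 2 ^ (k + 1) \<le> vnk x" "vnk x < 1 / 2 ^ k"
  using assms vnk_eq[OF assms] by (auto simp: vnk_piece_def field_simps)

lemma vnk_bounds:
  shows "0 \<le> vnk x" "vnk x < 1"
proof -
  have "0 \<le> vnk x \<and> vnk x < 1"
  proof (cases "\<exists>k. x \<in> vnk_piece k")
    case True
    then obtain k where k: "x \<in> vnk_piece k" by blast
    have "(1::real) / 2 ^ k \<le> 1" by simp
    moreover have "(0::real) \<le> 1 / 2 ^ (k+1)" by simp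
    ultimately show ?thesis using vnk_bounds_piece[OF k] by linarith
  qed (simp add: vnk_def)
  then show "0 \<le> vnk x" "vnk x < 1" by auto
qed

lemma vnk_iterate_bounds:
  assumes "0 \<le> x" "x < 1"
  shows "0 \<le> (vnk ^^ m) x" "(vnk ^^ m) x < 1"
  using assms vnk_bounds by (cases m; simp)+

lemma vnk_lower_half: "0 \<le> x \<Longrightarrow> x < 1/2 \<Longrightarrow> vnk x = x + 1/2"
  using vnk_eq[of x 0] by (simp add: vnk_piece_def)

text \<open>Self-similarity: \<open>2 * x - 1\<close> carries the piece of index
  \<open>Suc k\<close> to the piece of index \<open>k\<close>, and the image doubles. This is the
  carry of the odometer.\<close>

lemma vnk_upper_half:
  assumes "1/2 \<le> x" "x < 1"
  shows "vnk x = vnk (2 * x - 1) / 2"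
proof -
  obtain k where k: "2 * x - 1 \<in> vnk_piece k"
    using vnk_piece_exists[of "2 * x - 1"] assms by auto
  then have "x \<in> vnk_piece (Suc k)"
    by (auto simp: vnk_piece_def field_simps)
  from vnk_eq[OF this] vnk_eq[OF k] show ?thesis by (simp add: diff_divide_distrib add_divide_distrib)
qed

text \<open>Reads the first binary digits of \<open>x\<close> with the least significant digit first. The map
  \<^const>\<open>vnk\<close> then becomes the addition of \<open>1\<close>.\<close>

primrec odometer :: "nat \<Rightarrow> real \<Rightarrow> nat" where
  "odometer 0 x = 0"
| "odometer (Suc n) x =
     (if x < 1/2 then 2 * odometer n (2 * x) else Suc (2 * odometer n (2 * x - 1)))"

lemma odometer_less: "odometer n x < 2 ^ n"
proof (induction n arbitrary: x)
  case (Suc n)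
  from Suc[of "2 * x"] Suc[of "2 * x - 1"] show ?case by auto
qed simp

text \<open>In the lower half the first digit 0 becomes 1; in the upper half it becomes 0 and the
  carry passes to the remaining digits, by \<open>vnk_upper_half\<close>. Working modulo
  \<open>2 ^ n\<close> absorbs the overflow when all digits are 1.\<close>

lemma odometer_vnk:
  assumes "0 \<le> x" "x < 1"
  shows "odometer n (vnk x) mod 2 ^ n = Suc (odometer n x) mod 2 ^ n"
  using assms
proof (induction n arbitrary: x)
  case (Suc n)
  show ?case
  proof (cases "x < 1/2")
    case True
    with Suc.prems have "vnk x = x + 1/2" by (intro vnk_lower_half)
    with True Suc.prems show ?thesis by (simp add: algebra_simps)
  next
    case False
    with Suc.prems have v: "vnk x = vnk (2 * x - 1) / 2" by (intro vnk_upper_half) auto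
    have "odometer n (vnk (2 * x - 1)) mod 2 ^ n = Suc (odometer n (2 * x - 1)) mod 2 ^ n"
      using False Suc.prems by (intro Suc.IH) auto
    then have "2 * odometer n (vnk (2 * x - 1)) mod 2 ^ Suc n
      = 2 * Suc (odometer n (2 * x - 1)) mod 2 ^ Suc n"
      by (metis mult_mod_right power_Suc)
    moreover have "vnk x < 1/2" "2 * vnk x = vnk (2 * x - 1)"
      using v vnk_bounds(2)[of "2 * x - 1"] by auto
    ultimately show ?thesis using False by simp
  qed
qed simp

lemma odometer_iterate:
  assumes "0 \<le> x" "x < 1"
  shows "odometer n ((vnk ^^ m) x) = (odometer n x + m) mod 2 ^ n"
proof (induction m)
  case 0
  show ?case using odometer_less[of n x] by simp
next
  case (Suc m)
  have "odometer n ((vnk ^^ Suc m) x) mod 2 ^ n = Suc (odometer n ((vnk ^^ m) x)) mod 2 ^ n"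
    using odometer_vnk vnk_iterate_bounds[OF assms] by simp
  with Suc odometer_less[of n "(vnk ^^ Suc m) x"] show ?case
    by (simp add: mod_Suc_eq)
qed

text \<open>Both numbers consist of the first \<open>n\<close> binary digits, once in reversed and
  once in usual order, so each of them determines the digits.\<close>

lemma odometer_eq_iff:
  fixes x y :: real
  assumes "0 \<le> x" "x < 1" "0 \<le> y" "y < 1"
  shows "odometer n x = odometer n y \<longleftrightarrow> \<lfloor>2 ^ n * x\<rfloor> = \<lfloor>2 ^ n * y\<rfloor>"
  using assms
proof (induction n arbitrary: x y)
  case 0
  then have "\<lfloor>x\<rfloor> = 0" "\<lfloor>y\<rfloor> = 0" by linarith+
  then show ?case by simp
next
  case (Suc n)
  have lower: "\<lfloor>2 ^ Suc n * z\<rfloor> = \<lfloor>2 ^ n * (2 * z)\<rfloor>" for z :: real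
    by (simp add: ac_simps)
  have upper: "\<lfloor>2 ^ Suc n * z\<rfloor> = \<lfloor>2 ^ n * (2 * z - 1)\<rfloor> + 2 ^ n" for z :: real
  proof -
    have "2 ^ Suc n * z = 2 ^ n * (2 * z - 1) + of_int (2 ^ n)" by (simp add: algebra_simps)
    then show ?thesis by (simp only: floor_add_int)
  qed
  have lower_less: "\<lfloor>2 ^ Suc n * z\<rfloor> < 2 ^ n" if "z < 1/2" for z :: real
  proof -
    have "2 ^ n * (2 * z) < 2 ^ n * 1" using that by (intro mult_strict_left_mono) auto
    then show ?thesis by (simp add: floor_less_iff ac_simps)
  qed
  have upper_ge: "\<lfloor>2 ^ Suc n * z\<rfloor> \<ge> 2 ^ n" if "z \<ge> 1/2" for z :: real
  proof -
    have "2 ^ n * (2 * z) \<ge> 2 ^ n * 1" using that by (intro mult_left_mono) auto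
    then show ?thesis by (simp add: le_floor_iff ac_simps)
  qed
  have parity: "2 * a \<noteq> Suc (2 * b)" for a b by presburger
  show ?case
  proof (cases "x < 1/2"; cases "y < 1/2")
    assume "x < 1/2" "y < 1/2"
    with Suc.IH[of "2 * x" "2 * y"] Suc.prems show ?thesis
      by (simp only: lower odometer.simps if_True) auto
  next
    assume *: "\<not> x < 1/2" "\<not> y < 1/2"
    with Suc.IH[of "2 * x - 1" "2 * y - 1"] Suc.prems show ?thesis
      by (simp only: upper odometer.simps if_False) auto
  next
    assume "x < 1/2" "\<not> y < 1/2"
    with lower_less[of x] upper_ge[of y] parity show ?thesis by auto
  next
    assume "\<not> x < 1/2" "y < 1/2"
    with lower_less[of y] upper_ge[of x] parity show ?thesis
      by (auto dest: sym)
  qed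
qed

lemma vnk_iterate_same_cell_iff:
  assumes "0 \<le> x" "x < 1"
  shows "\<lfloor>2 ^ n * (vnk ^^ m) x\<rfloor> = \<lfloor>2 ^ n * x\<rfloor> \<longleftrightarrow> 2 ^ n dvd m"
proof -
  have "\<lfloor>2 ^ n * (vnk ^^ m) x\<rfloor> = \<lfloor>2 ^ n * x\<rfloor> \<longleftrightarrow> (odometer n x + m) mod 2 ^ n = odometer n x"
    using odometer_eq_iff[of "(vnk ^^ m) x" x n] vnk_iterate_bounds[OF assms] assms
      odometer_iterate[OF assms] by simp
  also have "\<dots> \<longleftrightarrow> (odometer n x + m) mod 2 ^ n = (odometer n x + 0) mod 2 ^ n"
    using odometer_less[of n x] by simp
  also have "\<dots> \<longleftrightarrow> 2 ^ n dvd m"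
    using mod_eq_dvd_iff_nat[of "odometer n x" "odometer n x + m" "2 ^ n"] by simp
  finally show ?thesis .
qed

lemma vnk_visits_cell:
  fixes x y :: real
  assumes "0 \<le> x" "x < 1" "0 \<le> y" "y < 1"
  obtains m where "\<lfloor>2 ^ n * (vnk ^^ m) x\<rfloor> = \<lfloor>2 ^ n * y\<rfloor>"
proof
  \<comment> \<open>The summand \<open>2 ^ n\<close> keeps the subtraction of natural numbers from
    truncating and vanishes modulo \<open>2 ^ n\<close>.\<close>
  let ?m = "2 ^ n - odometer n x + odometer n y"
  have "odometer n ((vnk ^^ ?m) x) = odometer n y"
    using odometer_iterate[OF assms(1,2), of n ?m] odometer_less[of n x] odometer_less[of n y]
    by simp
  then show "\<lfloor>2 ^ n * (vnk ^^ ?m) x\<rfloor> = \<lfloor>2 ^ n * y\<rfloor>"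
    using odometer_eq_iff vnk_iterate_bounds assms by simp
qed

section \<open>Elementary bounds on return times\<close>

lemma return_time_le: "0 < m \<Longrightarrow> (T ^^ m) x \<in> A \<Longrightarrow> return_time T A x \<le> enat m"
  unfolding return_time_def by (rule INF_lower) simp

lemma return_time_ge:
  assumes "\<And>m. 0 < m \<Longrightarrow> m < n \<Longrightarrow> (T ^^ m) x \<notin> A"
  shows "enat n \<le> return_time T A x"
  unfolding return_time_def using assms by (intro INF_greatest) (auto simp flip: not_less)

lemma return_time_ge_1: "1 \<le> return_time T A x"
  using return_time_ge[of 1 T x A] by (simp add: one_enat_def)

lemma return_time_eq_SucD: "return_time T A x = enat m \<Longrightarrow> m > 0"
  using return_time_ge_1[of T A x] by (simp add: one_enat_def)

lemma less_return_time_iff: "enat n < return_time T A x \<longleftrightarrow> (\<forall>m\<in>{1..n}. (T ^^ m) x \<notin> A)"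
proof
  assume n: "enat n < return_time T A x"
  show "\<forall>m\<in>{1..n}. (T ^^ m) x \<notin> A"
  proof (intro ballI notI)
    fix m assume "m \<in> {1..n}" "(T ^^ m) x \<in> A"
    then have "return_time T A x \<le> enat m" by (intro return_time_le) auto
    also have "\<dots> \<le> enat n" using \<open>m \<in> {1..n}\<close> by simp
    finally show False using n by (simp add: leD)
  qed
next
  assume "\<forall>m\<in>{1..n}. (T ^^ m) x \<notin> A"
  then have "enat (Suc n) \<le> return_time T A x" by (intro return_time_ge) auto
  then show "enat n < return_time T A x" by (simp add: Suc_ile_eq)
qed

section \<open>Invariance of Lebesgue measure and Kac's formula\<close>

text \<open>The events \<open>enat n < return_time T A x\<close> are finite intersections of
  measurable sets; each level set, also that of infinity, is a countable combination of them, and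
  \<open>enat\<close> is countable.\<close>

lemma measurable_return_time:
  assumes [measurable]: "T \<in> M \<rightarrow>\<^sub>M M" "A \<in> sets M"
  shows "return_time T A \<in> M \<rightarrow>\<^sub>M count_space UNIV"
proof -
  have [measurable]: "(T ^^ n) \<in> M \<rightarrow>\<^sub>M M" for n
    by (rule measurable_compose_n) simp
  have lt [measurable]: "Measurable.pred M (\<lambda>x. enat n < return_time T A x)" for n
    unfolding less_return_time_iff by measurable
  have eq: "return_time T A x = e \<longleftrightarrow> (case e of \<infinity> \<Rightarrow> \<forall>n. enat n < return_time T A x
      | enat n \<Rightarrow> enat n \<le> return_time T A x \<and> \<not> enat n < return_time T A x)" for x e
    by (cases e; cases "return_time T A x") (auto intro: less_le_trans)
  have le: "enat n \<le> return_time T A x \<longleftrightarrow> (case n of 0 \<Rightarrow> True | Suc m \<Rightarrow> enat m < return_time T A x)" for n x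
    by (cases n) (auto simp: Suc_ile_eq enat_0)
  have "Measurable.pred M (\<lambda>x. return_time T A x = e)" for e
    unfolding eq le by (cases e) (auto split: nat.split)
  then have "{x \<in> space M. return_time T A x = e} \<in> sets M" for e
    by (rule predE)
  moreover have "return_time T A -` {e} \<inter> space M = {x \<in> space M. return_time T A x = e}" for e
    by auto
  ultimately show ?thesis
    by (subst measurable_count_space_eq_countable) auto
qed

text \<open>The set of points of \<open>A\<close> with return time above \<open>t\<close> has measure
  \<open>\<mu>(B t) - \<mu>(B (t + 1))\<close>, where \<open>B t\<close> consists of the points that avoid \<open>A\<close> during the first \<open>t\<close>
  steps, so the tail sum of the return time telescopes.\<close>

lemma kac:
  assumes "finite_measure M"
    and T [measurable]: "T \<in> M \<rightarrow>\<^sub>M M" and inv: "distr M M T = M" and A [measurable]: "A \<in> sets M"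
    and visit: "AE x in M. \<exists>m. (T ^^ m) x \<in> A"
  shows "(\<integral>\<^sup>+x\<in>A. ennreal_of_enat (return_time T A x) \<partial>M) = emeasure M (space M)"
proof -
  interpret finite_measure M by fact
  have [measurable]: "(T ^^ n) \<in> M \<rightarrow>\<^sub>M M" for n
    by (rule measurable_compose_n) simp
  have [measurable]: "return_time T A \<in> M \<rightarrow>\<^sub>M count_space UNIV"
    by (rule measurable_return_time) simp_all
  define B where "B n = {x \<in> space M. \<forall>m<n. (T ^^ m) x \<notin> A}" for n :: nat
  define C where "C n = {x \<in> space M. x \<in> A \<and> (\<forall>m<n. (T ^^ Suc m) x \<notin> A)}" for n :: nat
  have [measurable]: "B n \<in> sets M" "C n \<in> sets M" for n
    unfolding B_def C_def by measurable
  have C: "measure M (C n) = measure M (B n) - measure M (B (Suc n))" for n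
  proof -
    \<comment> \<open>Points avoiding \<open>A\<close> at times 1 to \<open>n\<close> are split by
      whether they lie in \<open>A\<close> at time 0; by invariance their set has the measure of
      \<open>B n\<close>.\<close>
    have "T -` B n \<inter> space M = {x \<in> space M. \<forall>m<n. (T ^^ Suc m) x \<notin> A}"
      using measurable_space[OF T] by (auto simp: B_def funpow_Suc_right simp del: funpow.simps)
    also have "\<dots> = B (Suc n) \<union> C n"
      by (auto simp: B_def C_def less_Suc_eq_0_disj)
    finally have "measure M (B n) = measure M (B (Suc n) \<union> C n)"
      using measure_distr[OF T, of "B n"] inv by simp
    also have "\<dots> = measure M (B (Suc n)) + measure M (C n)"
      by (rule finite_measure_Union) (auto simp: B_def C_def)
    finally show ?thesis by simp
  qed
  have "(\<lambda>n. measure M (B n)) \<longlonglongrightarrow> measure M (\<Inter>n. B n)"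
    by (rule finite_Lim_measure_decseq) (auto simp: decseq_def B_def)
  \<comment> \<open>The intersection consists of the points whose orbit never meets
    \<open>A\<close>; \<open>visit\<close> makes it a null set.\<close>
  moreover have "measure M (\<Inter>n. B n) = 0"
  proof -
    have "(\<Inter>n. B n) \<in> null_sets M"
      using visit by (intro iffD2[OF AE_iff_null_sets]) (auto simp: B_def elim!: eventually_mono)
    then show ?thesis by (simp add: measure_eq_0_null_sets)
  qed
  ultimately have lim: "(\<lambda>n. measure M (B n)) \<longlonglongrightarrow> 0" by simp
  have "(\<integral>\<^sup>+x\<in>A. ennreal_of_enat (return_time T A x) \<partial>M) =
        (\<integral>\<^sup>+x. ennreal_of_enat (if x \<in> A then return_time T A x else 0) \<partial>M)"
    by (intro nn_integral_cong) (auto simp: indicator_def)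
  also have "\<dots> = (\<Sum>n. emeasure M {x \<in> space M. n < (if x \<in> A then return_time T A x else 0)})"
    by (rule nn_integral_enat_function) measurable
  also have "\<dots> = (\<Sum>n. emeasure M (C n))"
  proof (intro suminf_cong arg_cong2[where f = emeasure] refl)
    fix n
    have "(\<forall>m\<in>{1..n}. (T ^^ m) x \<notin> A) \<longleftrightarrow> (\<forall>m<n. (T ^^ Suc m) x \<notin> A)" for x
      by (auto simp del: funpow.simps) (metis Suc_le_eq Suc_pred less_eq_Suc_le)
    then show "{x \<in> space M. enat n < (if x \<in> A then return_time T A x else 0)} = C n"
      by (auto simp: C_def less_return_time_iff simp del: funpow.simps split: if_splits)
  qed
  also have "\<dots> = (\<Sum>n. ennreal (measure M (B n) - measure M (B (Suc n))))"
    by (simp add: emeasure_eq_measure C)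
  also have "\<dots> = ennreal (measure M (B 0) - 0)"
    using C by (intro suminf_ennreal_eq telescope_sums' lim) (metis measure_nonneg)
  also have "\<dots> = emeasure M (space M)"
    by (simp add: B_def emeasure_eq_measure)
  finally show ?thesis .
qed

section \<open>Lebesgue measure on the unit interval and its invariance\<close>

lemma unit_lebesgue_space [simp]: "space unit_lebesgue = {0..1}"
  by (simp add: unit_lebesgue_def space_restrict_space)

lemma sets_unit_lebesgue: "A \<in> sets unit_lebesgue \<longleftrightarrow> A \<in> sets borel \<and> A \<subseteq> {0..1}"
  unfolding unit_lebesgue_def by (subst sets_restrict_space_iff) auto

lemma emeasure_unit_lebesgue: "A \<subseteq> {0..1} \<Longrightarrow> emeasure unit_lebesgue A = emeasure lborel A"
  unfolding unit_lebesgue_def by (rule emeasure_restrict_space) auto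

lemma emeasure_unit_lebesgue_space [simp]: "emeasure unit_lebesgue {0..1} = 1"
  by (simp add: emeasure_unit_lebesgue)

interpretation unit_lebesgue: finite_measure unit_lebesgue
  by (rule finite_measureI) simp

lemma AE_unit_lebesgue: "AE x in unit_lebesgue. 0 \<le> x \<and> x < 1"
proof -
  have "AE x in lborel. x \<noteq> (1::real)"
    by (rule AE_lborel_singleton)
  then show ?thesis
    unfolding unit_lebesgue_def by (subst AE_restrict_space_iff) (auto elim!: eventually_mono)
qed

lemma vnk_piece_Union: "(\<Union>k. vnk_piece k) = {0..<1}"
proof -
  have "x \<in> {0..<1}" if "x \<in> vnk_piece k" for x k
  proof -
    have "(1::real) / 2 ^ k \<le> 1" "(0::real) < 1 / 2 ^ (k+1)" by simp_all
    moreover have "1 - 1 / 2 ^ k \<le> x" "x < 1 - 1 / 2 ^ (k + 1)"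
      using that by (auto simp: vnk_piece_def)
    ultimately show ?thesis unfolding atLeastLessThan_iff by linarith
  qed
  moreover have "\<exists>k. x \<in> vnk_piece k" if "x \<in> {0..<1}" for x
  proof -
    from that have "0 \<le> x" "x < 1" by auto
    then show ?thesis by (rule vnk_piece_exists) blast
  qed
  ultimately show ?thesis by blast
qed

definition vnk_image :: "nat \<Rightarrow> real set" where
  "vnk_image k = {1 / 2 ^ (k + 1) ..< 1 / 2 ^ k}"

lemma vnk_image_iff: "x - 1 + 1 / 2 ^ k + 1 / 2 ^ (k + 1) \<in> vnk_image k \<longleftrightarrow> x \<in> vnk_piece k"
proof -
  have half: "1 / 2 ^ (k + 1) = 1 / 2 ^ k / (2::real)" by simp
  show ?thesis unfolding vnk_image_def vnk_piece_def half by auto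
qed

lemma vnk_image_Union: "(\<Union>k. vnk_image k) = {0<..<1}"
proof -
  have "x \<in> {0<..<1}" if "x \<in> vnk_image k" for x k
  proof -
    have "(1::real) / 2 ^ k \<le> 1" "(0::real) < 1 / 2 ^ (k+1)" by simp_all
    moreover have "1 / 2 ^ (k + 1) \<le> x" "x < 1 / 2 ^ k"
      using that by (auto simp: vnk_image_def)
    ultimately show ?thesis unfolding greaterThanLessThan_iff by linarith
  qed
  moreover have "\<exists>k. x \<in> vnk_image k" if x: "x \<in> {0<..<1}" for x
  proof -
    let ?P = "\<lambda>k. 1 / 2 ^ (k + 1) \<le> x"
    obtain n where "(1/2) ^ n < x"
      using x real_arch_pow_inv[of x "1/2"] by auto
    moreover have "(1/2::real) ^ (n + 1) \<le> (1/2) ^ n" by simp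
    ultimately have "?P n" by (simp add: power_divide)
    define k where "k = (LEAST k. ?P k)"
    have "?P k" unfolding k_def using \<open>?P n\<close> by (rule LeastI)
    moreover have "x < 1 / 2 ^ k"
    proof (cases k)
      case (Suc m)
      then have "\<not> ?P m" using not_less_Least[of m ?P] unfolding k_def by simp
      then show ?thesis using Suc by simp
    qed (use x in simp)
    ultimately show ?thesis by (auto simp: vnk_image_def)
  qed
  ultimately show ?thesis by blast
qed

lemma disjoint_vnk_piece: "disjoint_family vnk_piece"
  using vnk_piece_unique by (auto simp: disjoint_family_on_def)

lemma disjoint_vnk_image: "disjoint_family vnk_image"
proof -
  have le: "l \<le> k" if "x \<in> vnk_image k" "x \<in> vnk_image l" for x k l
  proof (rule ccontr)
    assume "\<not> l \<le> k"
    then have "(2::real) ^ (k + 1) \<le> 2 ^ l" by (intro power_increasing) auto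
    then have "1 / (2::real) ^ l \<le> 1 / 2 ^ (k + 1)" by (intro divide_left_mono) auto
    with that show False by (auto simp: vnk_image_def)
  qed
  show ?thesis
    unfolding disjoint_family_on_def
  proof (intro ballI impI equals0I)
    fix k l x assume "k \<noteq> l" "x \<in> vnk_image k \<inter> vnk_image l"
    with le[of x k l] le[of x l k] show False by simp
  qed
qed

lemma emeasure_lborel_translate:
  fixes c :: "'a::euclidean_space"
  assumes "B \<in> sets borel"
  shows "emeasure lborel ((+) c -` B) = emeasure lborel B"
  using assms emeasure_distr[of "(+) c" lborel borel B] by (simp add: lborel_distr_plus)

lemma measurable_vnk [measurable]: "vnk \<in> borel \<rightarrow>\<^sub>M borel"
proof (rule measurableI)
  fix B :: "real set" assume [measurable]: "B \<in> sets borel"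
  have "vnk -` B \<inter> space borel = (\<Union>k. vnk_piece k \<inter> (\<lambda>x. x - 1 + 1 / 2 ^ k + 1 / 2 ^ (k + 1)) -` B)
      \<union> ((- (\<Union>k. vnk_piece k)) \<inter> (\<lambda>x. 0) -` B)"
  proof (intro set_eqI)
    fix x
    show "x \<in> vnk -` B \<inter> space borel \<longleftrightarrow>
      x \<in> (\<Union>k. vnk_piece k \<inter> (\<lambda>x. x - 1 + 1 / 2 ^ k + 1 / 2 ^ (k + 1)) -` B) \<union> (- (\<Union>k. vnk_piece k)) \<inter> (\<lambda>x. 0) -` B"
    proof (cases "\<exists>k. x \<in> vnk_piece k")
      case True
      then obtain k where k: "x \<in> vnk_piece k" by blast
      then have "x \<in> vnk_piece l \<longleftrightarrow> l = k" for l using vnk_piece_unique by blast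
      with vnk_eq[OF k] show ?thesis by simp
    qed (simp add: vnk_def)
  qed
  also have "\<dots> \<in> sets borel"
    unfolding vnk_piece_Union by (intro sets.Un sets.countable_UN) (auto simp: vnk_piece_def intro!: measurable_sets_borel)
  finally show "vnk -` B \<inter> space borel \<in> sets borel" .
qed simp

lemma measurable_vnk_unit [measurable]: "vnk \<in> unit_lebesgue \<rightarrow>\<^sub>M unit_lebesgue"
  unfolding unit_lebesgue_def
proof (rule measurable_restrict_space3)
  show "vnk \<in> {0..1} \<rightarrow> {0..1}" using vnk_bounds(1) less_imp_le[OF vnk_bounds(2)] by auto
qed simp

text \<open>On \<open>vnk_piece k\<close> the map is a translation onto \<open>vnk_image k\<close>.
  Both families are disjoint and fill the unit interval up to endpoints, so the translated parts of
  a preimage reassemble to the set.\<close>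

lemma vnk_preserves: "distr unit_lebesgue unit_lebesgue vnk = unit_lebesgue"
proof (rule measure_eqI)
  fix B assume "B \<in> sets (distr unit_lebesgue unit_lebesgue vnk)"
  then have B [measurable]: "B \<in> sets borel" and B1: "B \<subseteq> {0..1}" by (auto simp: sets_unit_lebesgue)
  have [measurable]: "vnk_piece k \<in> sets borel" "vnk_image k \<in> sets borel" for k
    by (auto simp: vnk_piece_def vnk_image_def)
  have [measurable]: "vnk -` B \<in> sets borel"
    by (rule measurable_sets_borel) measurable
  have ends: "AE x in lborel. x \<noteq> (0::real)" "AE x in lborel. x \<noteq> (1::real)"
    by (rule AE_lborel_singleton)+
  have "emeasure (distr unit_lebesgue unit_lebesgue vnk) B = emeasure lborel (vnk -` B \<inter> {0..1})"
    using B B1 by (subst emeasure_distr) (auto simp: sets_unit_lebesgue emeasure_unit_lebesgue)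
  also have "\<dots> = emeasure lborel (vnk -` B \<inter> {0..<1})"
  proof (rule emeasure_eq_AE)
    show "AE x in lborel. x \<in> vnk -` B \<inter> {0..1} \<longleftrightarrow> x \<in> vnk -` B \<inter> {0..<1}"
      using ends(2) by eventually_elim auto
  qed simp_all
  also have "vnk -` B \<inter> {0..<1} = (\<Union>k. vnk -` B \<inter> vnk_piece k)"
    unfolding vnk_piece_Union[symmetric] by blast
  also have "emeasure lborel \<dots> = (\<Sum>k. emeasure lborel (vnk -` B \<inter> vnk_piece k))"
    using disjoint_vnk_piece
    by (intro suminf_emeasure[symmetric]) (auto simp: disjoint_family_on_def)
  also have "\<dots> = (\<Sum>k. emeasure lborel (B \<inter> vnk_image k))"
  proof (rule suminf_cong)
    fix k
    define c :: real where "c = - 1 + 1 / 2 ^ k + 1 / 2 ^ (k + 1)"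
    have image: "c + x \<in> vnk_image k \<longleftrightarrow> x \<in> vnk_piece k" for x
      using vnk_image_iff[of x k] by (simp add: c_def algebra_simps)
    have "vnk x = c + x" if "x \<in> vnk_piece k" for x
      using vnk_eq[OF that] by (simp add: c_def)
    then have "vnk -` B \<inter> vnk_piece k = (+) c -` (B \<inter> vnk_image k)"
      using image by auto
    also have "emeasure lborel \<dots> = emeasure lborel (B \<inter> vnk_image k)"
      by (rule emeasure_lborel_translate) simp
    finally show "emeasure lborel (vnk -` B \<inter> vnk_piece k) = emeasure lborel (B \<inter> vnk_image k)" .
  qed
  also have "\<dots> = emeasure lborel (\<Union>k. B \<inter> vnk_image k)"
    using disjoint_vnk_image by (intro suminf_emeasure) (auto simp: disjoint_family_on_def)
  also have "(\<Union>k. B \<inter> vnk_image k) = B \<inter> {0<..<1}"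
    unfolding vnk_image_Union[symmetric] by blast
  also have "emeasure lborel (B \<inter> {0<..<1}) = emeasure lborel B"
  proof (rule emeasure_eq_AE)
    show "AE x in lborel. x \<in> B \<inter> {0<..<1} \<longleftrightarrow> x \<in> B"
      using ends by eventually_elim (use B1 in \<open>auto simp: less_le\<close>)
  qed simp_all
  also have "\<dots> = emeasure unit_lebesgue B"
    using B1 by (simp add: emeasure_unit_lebesgue)
  finally show "emeasure (distr unit_lebesgue unit_lebesgue vnk) B = emeasure unit_lebesgue B" .
qed simp

text \<open>Every orbit starting in [0,1) visits every dyadic cell, so it suffices that
  \<open>{u..v}\<close> contains one.\<close>

lemma vnk_kac:
  assumes "A \<in> sets unit_lebesgue" "u < v" "{u..v} \<subseteq> A"
  shows "(\<integral>\<^sup>+x\<in>A. ennreal_of_enat (return_time vnk A x) \<partial>unit_lebesgue) = 1"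
proof -
  have uv: "0 \<le> u" "v \<le> 1" using assms by (auto simp: sets_unit_lebesgue subset_iff)
  \<comment> \<open>After scaling by \<open>2 ^ n\<close> the interval is longer than 2: rounding
    its left end up to an integer costs less than 1, and a dyadic cell starting there needs 1. The
    point \<open>y\<close> below is the left end of that cell.\<close>
  obtain n where "(1/2) ^ n < (v - u) / 2"
    using assms(2) real_arch_pow_inv[of "(v - u) / 2" "1/2"] by auto
  then have n: "2 < 2 ^ n * (v - u)" by (simp add: field_simps)
  define y where "y = of_int \<lceil>2 ^ n * u\<rceil> / (2 ^ n :: real)"
  have y: "2 ^ n * y = of_int \<lceil>2 ^ n * u\<rceil>" by (simp add: y_def)
  then have yu: "2 ^ n * u \<le> 2 ^ n * y" "2 ^ n * y < 2 ^ n * u + 1" by linarith+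
  with n have yv: "2 ^ n * y + 1 < 2 ^ n * v" by (simp add: algebra_simps)
  have y01: "0 \<le> y" "y < 1"
  proof -
    have "u \<le> y" using yu(1) by simp
    with uv show "0 \<le> y" by simp
    have "2 ^ n * y < 2 ^ n * v" using yv by linarith
    then have "y < v" by simp
    with uv show "y < 1" by simp
  qed
  have vis: "\<exists>m. (vnk ^^ m) x \<in> A" if x: "0 \<le> x \<and> x < 1" for x
  proof -
    obtain m where "\<lfloor>2 ^ n * (vnk ^^ m) x\<rfloor> = \<lfloor>2 ^ n * y\<rfloor>"
      using vnk_visits_cell x y01 by blast
    then have "\<lfloor>2 ^ n * (vnk ^^ m) x\<rfloor> = \<lceil>2 ^ n * u\<rceil>" using y by simp
    then have "2 ^ n * u \<le> 2 ^ n * (vnk ^^ m) x" "2 ^ n * (vnk ^^ m) x \<le> 2 ^ n * v"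
      using yv y by linarith+
    then have "(vnk ^^ m) x \<in> {u..v}" by simp
    with assms show ?thesis by blast
  qed
  have "AE x in unit_lebesgue. \<exists>m. (vnk ^^ m) x \<in> A"
    by (rule eventually_mono[OF AE_unit_lebesgue vis])
  from kac[OF unit_lebesgue.finite_measure_axioms measurable_vnk_unit vnk_preserves assms(1) this] show ?thesis
    by (simp add: emeasure_unit_lebesgue)
qed

section \<open>Jensen's inequality for return times\<close>

lemma epowr_ennreal: "0 \<le> c \<Longrightarrow> epowr (ennreal c) a = ennreal (c powr a)"
  by (simp add: epowr_def)

lemma epowr_mono: "0 \<le> a \<Longrightarrow> z \<le> w \<Longrightarrow> w \<noteq> 0 \<Longrightarrow> epowr z a \<le> epowr w a"
  by (cases z; cases w) (auto simp: epowr_def powr_mono2 top_unique intro!: ennreal_leI)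

text \<open>The hypothesis \<open>0 < z\<close> excludes the default \<open>0 powr a = 0\<close>,
  which breaks antitonicity for negative \<open>a\<close>.\<close>

lemma epowr_antimono: "a \<le> 0 \<Longrightarrow> 0 < z \<Longrightarrow> z \<le> w \<Longrightarrow> epowr w a \<le> epowr z a"
  by (cases z; cases w) (auto simp: epowr_def powr_mono2' top_unique intro!: ennreal_leI)

lemma eln_ennreal: "0 < c \<Longrightarrow> eln (ennreal c) = ereal (ln c)"
  by (simp add: eln_def)

lemma eln_mono: "z \<le> w \<Longrightarrow> eln z \<le> eln w"
  by (cases z; cases w) (auto simp: eln_def top_unique)

lemma ennreal_of_enat_mono: "m \<le> n \<Longrightarrow> ennreal_of_enat m \<le> ennreal_of_enat n"
  by simp

lemma ennreal_of_enat_nat: "ennreal_of_enat (enat n) = ennreal (real n)"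
  by (simp add: ennreal_of_nat_eq_real_of_nat)

lemma return_time_pos: "0 < ennreal_of_enat (return_time T A x)"
proof -
  have "ennreal_of_enat (enat 1) \<le> ennreal_of_enat (return_time T A x)"
    using return_time_ge_1[of T A x] by (intro ennreal_of_enat_mono) (simp add: one_enat_def)
  then show ?thesis
    by (simp add: ennreal_of_enat_nat less_le_trans[of 0 1])
qed

lemma return_pow_eq:
  "return_time T A x = enat m \<Longrightarrow> return_pow T q A x = ennreal (real m powr (1 - q))"
  unfolding return_pow_def by (simp only: ennreal_of_enat_nat epowr_ennreal of_nat_0_le_iff)

lemma return_log_eq:
  "return_time T A x = enat m \<Longrightarrow> return_log T A x = ennreal (ln (real m))"
  unfolding return_log_def using return_time_eq_SucD[of T A x m]
  by (simp only: ennreal_of_enat_nat eln_ennreal of_nat_0_less_iff e2ennreal_ereal)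

text \<open>The sign of \<open>1 - q\<close> decides whether a bound on the return time keeps its
  direction; hence four variants, whose last suffix tells on which side the return time is
  bounded.\<close>

lemma return_pow_le_upper:
  assumes "q \<le> 1" "return_time T A x \<le> enat b" "0 < b"
  shows "return_pow T q A x \<le> ennreal (real b powr (1 - q))"
  unfolding return_pow_def using assms ennreal_of_enat_mono[OF assms(2)]
  by (subst epowr_ennreal[symmetric])
     (auto simp: ennreal_of_enat_nat simp del: ennreal_of_enat_enat intro!: epowr_mono)

lemma return_pow_ge_lower:
  assumes "q \<le> 1" "enat b \<le> return_time T A x"
  shows "ennreal (real b powr (1 - q)) \<le> return_pow T q A x"
  unfolding return_pow_def using assms ennreal_of_enat_mono[OF assms(2)] return_time_pos[of T A x]
  by (subst epowr_ennreal[symmetric])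
     (auto simp: ennreal_of_enat_nat simp del: ennreal_of_enat_enat intro!: epowr_mono)

lemma return_pow_ge_upper:
  assumes "1 \<le> q" "return_time T A x \<le> enat b"
  shows "ennreal (real b powr (1 - q)) \<le> return_pow T q A x"
  unfolding return_pow_def using assms ennreal_of_enat_mono[OF assms(2)] return_time_pos[of T A x]
  by (subst epowr_ennreal[symmetric])
     (auto simp: ennreal_of_enat_nat simp del: ennreal_of_enat_enat intro!: epowr_antimono)

lemma return_pow_le_lower:
  assumes "1 \<le> q" "enat b \<le> return_time T A x" "0 < b"
  shows "return_pow T q A x \<le> ennreal (real b powr (1 - q))"
  unfolding return_pow_def using assms ennreal_of_enat_mono[OF assms(2)]
  by (subst epowr_ennreal[symmetric])
     (auto simp: ennreal_of_enat_nat simp del: ennreal_of_enat_enat intro!: epowr_antimono)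

lemma return_log_le:
  assumes "return_time T A x \<le> enat b" "0 < b"
  shows "return_log T A x \<le> ennreal (ln (real b))"
proof -
  have "eln (ennreal_of_enat (return_time T A x)) \<le> eln (ennreal (real b))"
    using ennreal_of_enat_mono[OF assms(1)] by (intro eln_mono) (simp only: ennreal_of_enat_nat)
  then show ?thesis
    using assms(2) e2ennreal_mono by (fastforce simp: return_log_def eln_ennreal)
qed

lemma return_log_ge:
  assumes "enat b \<le> return_time T A x" "0 < b"
  shows "ennreal (ln (real b)) \<le> return_log T A x"
proof -
  have "eln (ennreal (real b)) \<le> eln (ennreal_of_enat (return_time T A x))"
    using ennreal_of_enat_mono[OF assms(1)] by (intro eln_mono) (simp only: ennreal_of_enat_nat)
  then show ?thesis
    using assms(2) e2ennreal_mono by (fastforce simp: return_log_def eln_ennreal)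
qed

text \<open>\<open>ennreal\<close> replaces \<open>h\<close> by its positive part. Needed because
  tangent lines below a convex function may take negative values.\<close>

lemma ennreal_integral_le_nn_integral:
  assumes "integrable M h"
  shows "ennreal (integral\<^sup>L M h) \<le> (\<integral>\<^sup>+x. ennreal (h x) \<partial>M)"
proof -
  have "integral\<^sup>L M h \<le> (\<integral>x. max 0 (h x) \<partial>M)"
    using assms by (intro integral_mono) auto
  then have "ennreal (integral\<^sup>L M h) \<le> ennreal (\<integral>x. max 0 (h x) \<partial>M)"
    by (rule ennreal_leI)
  also have "\<dots> = (\<integral>\<^sup>+x. ennreal (max 0 (h x)) \<partial>M)"
    using assms by (intro nn_integral_eq_integral[symmetric]) auto
  also have "\<dots> = (\<integral>\<^sup>+x. ennreal (h x) \<partial>M)"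
    by (intro nn_integral_cong) (auto simp: max_def ennreal_neg)
  finally show ?thesis .
qed

text \<open>An affine function of the return time integrates over \<open>A\<close> to a value
  depending only on the measure of \<open>A\<close> and on \<open>I\<close>, which Kac's formula
  supplies. Since \<open>I\<close> is finite, return times are finite almost everywhere on
  \<open>A\<close>, so \<open>g\<close> is controlled at finite values only. The upper bound asks
  for nonnegativity because truncating negative values by \<open>ennreal\<close> would increase the
  integral.\<close>

lemma
  assumes "finite_measure M" and [measurable]: "T \<in> M \<rightarrow>\<^sub>M M" "A \<in> sets M" and "0 \<le> I"
    and I: "(\<integral>\<^sup>+x\<in>A. ennreal_of_enat (return_time T A x) \<partial>M) = ennreal I"
  shows return_time_affine_lower:
      "(\<And>x m. return_time T A x = enat m \<Longrightarrow> ennreal (\<alpha> + \<beta> * real m) \<le> g x) \<Longrightarrow>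
        ennreal (\<alpha> * measure M A + \<beta> * I) \<le> (\<integral>\<^sup>+x\<in>A. g x \<partial>M)"
    and return_time_affine_upper:
      "(\<And>x m. return_time T A x = enat m \<Longrightarrow> g x \<le> ennreal (\<alpha> + \<beta> * real m) \<and> 0 \<le> \<alpha> + \<beta> * real m) \<Longrightarrow>
        (\<integral>\<^sup>+x\<in>A. g x \<partial>M) \<le> ennreal (\<alpha> * measure M A + \<beta> * I)"
proof -
  interpret finite_measure M by fact
  have [measurable]: "return_time T A \<in> M \<rightarrow>\<^sub>M count_space UNIV"
    by (rule measurable_return_time) simp_all
  define f where "f x = indicator A x * real (the_enat (return_time T A x))" for x
  have [measurable]: "f \<in> borel_measurable M" unfolding f_def by measurable
  have "AE x in M. ennreal_of_enat (return_time T A x) * indicator A x \<noteq> \<infinity>"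
    using I by (intro nn_integral_noteq_infinite) (auto simp: measurable_compose)
  then have fin: "AE x in M. x \<in> A \<longrightarrow> (\<exists>m. return_time T A x = enat m)"
  proof eventually_elim
    case (elim x)
    then show ?case by (cases "return_time T A x") (auto simp: indicator_def)
  qed
  have "(\<integral>\<^sup>+x. ennreal (f x) \<partial>M) = (\<integral>\<^sup>+x\<in>A. ennreal_of_enat (return_time T A x) \<partial>M)"
    using fin by (intro nn_integral_cong_AE, eventually_elim)
      (auto simp: f_def indicator_def ennreal_of_nat_eq_real_of_nat)
  then have "has_bochner_integral M f I"
    using I \<open>0 \<le> I\<close> by (intro has_bochner_integral_nn_integral) (auto simp: f_def)
  then have f: "integrable M f" "integral\<^sup>L M f = I"
    by (auto simp: has_bochner_integral_iff)
  define h where "h x = \<alpha> * indicator A x + \<beta> * f x" for x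
  have "integrable M (indicat_real A)"
    by (rule integrable_real_indicator) (simp_all flip: less_top)
  then have h: "integrable M h" "integral\<^sup>L M h = \<alpha> * measure M A + \<beta> * I"
    unfolding h_def using f by simp_all
  have ind: "ennreal (h x) = ennreal (h x) * indicator A x" for x
    by (simp add: h_def f_def indicator_def)
  show "ennreal (\<alpha> * measure M A + \<beta> * I) \<le> (\<integral>\<^sup>+x\<in>A. g x \<partial>M)"
    if g: "\<And>x m. return_time T A x = enat m \<Longrightarrow> ennreal (\<alpha> + \<beta> * real m) \<le> g x"
  proof -
    have "ennreal (\<alpha> * measure M A + \<beta> * I) \<le> (\<integral>\<^sup>+x. ennreal (h x) \<partial>M)"
      using ennreal_integral_le_nn_integral[OF h(1)] h(2) by simp
    also have "\<dots> \<le> (\<integral>\<^sup>+x\<in>A. g x \<partial>M)"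
      using fin by (intro nn_integral_mono_AE, eventually_elim) (use g in \<open>auto simp: h_def f_def indicator_def\<close>)
    finally show ?thesis .
  qed
  show "(\<integral>\<^sup>+x\<in>A. g x \<partial>M) \<le> ennreal (\<alpha> * measure M A + \<beta> * I)"
    if g: "\<And>x m. return_time T A x = enat m \<Longrightarrow> g x \<le> ennreal (\<alpha> + \<beta> * real m) \<and> 0 \<le> \<alpha> + \<beta> * real m"
  proof -
    have "(\<integral>\<^sup>+x\<in>A. g x \<partial>M) \<le> (\<integral>\<^sup>+x. ennreal (h x) \<partial>M)"
      using fin by (intro nn_integral_mono_AE, eventually_elim) (use g in \<open>auto simp: h_def f_def indicator_def\<close>)
    also have "\<dots> = ennreal (integral\<^sup>L M h)"
      using fin by (intro nn_integral_eq_integral h, eventually_elim) (use g in \<open>auto simp: h_def f_def indicator_def\<close>)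
    finally show ?thesis using h(2) by simp
  qed
qed

text \<open>Convexity, as the second derivative has the sign of \<open>p * (p - 1)\<close>; the
  left-hand side is the tangent at \<open>s\<close>, rewritten with
  \<open>s powr (p - 1) * s = s powr p\<close>.\<close>

lemma powr_tangent_below:
  fixes s t p :: real
  assumes "0 < s" "0 < t" "1 \<le> p \<or> p \<le> 0"
  shows "(1 - p) * s powr p + p * s powr (p - 1) * t \<le> t powr p"
proof -
  have "p * s powr (p - 1) * (t - s) \<le> t powr p - s powr p"
  proof (rule f''_imp_f'[where C = "{0<..}" and f'' = "\<lambda>x. p * ((p - 1) * x powr (p - 2))"])
    fix x :: real assume "x \<in> {0<..}"
    then show "((\<lambda>x. x powr p) has_real_derivative p * x powr (p - 1)) (at x)"
      by (auto intro!: derivative_eq_intros)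
    show "((\<lambda>x. p * x powr (p - 1)) has_real_derivative p * ((p - 1) * x powr (p - 2))) (at x)"
      using \<open>x \<in> {0<..}\<close> by (auto intro!: derivative_eq_intros)
    show "0 \<le> p * ((p - 1) * x powr (p - 2))"
    proof -
      have "0 \<le> p * (p - 1)" using assms(3) by (auto simp: zero_le_mult_iff)
      then show ?thesis by (simp flip: mult.assoc)
    qed
  qed (use assms in auto)
  moreover have "s powr (p - 1) * s = s powr p"
    using assms by (simp add: powr_mult_base mult.commute)
  ultimately show ?thesis by (simp add: algebra_simps)
qed

text \<open>The concave counterpart, obtained from the convex function
  \<open>- (x powr p)\<close>.\<close>

lemma powr_tangent_above:
  fixes s t p :: real
  assumes "0 < s" "0 < t" "0 \<le> p" "p \<le> 1"
  shows "t powr p \<le> (1 - p) * s powr p + p * s powr (p - 1) * t"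
proof -
  have "(- p * s powr (p - 1)) * (t - s) \<le> - (t powr p) - - (s powr p)"
  proof (rule f''_imp_f'[where C = "{0<..}" and f'' = "\<lambda>x. p * ((1 - p) * x powr (p - 2))"])
    fix x :: real assume "x \<in> {0<..}"
    then show "((\<lambda>x. - (x powr p)) has_real_derivative - p * x powr (p - 1)) (at x)"
      by (auto intro!: derivative_eq_intros)
    show "((\<lambda>x. - p * x powr (p - 1)) has_real_derivative p * ((1 - p) * x powr (p - 2))) (at x)"
      using \<open>x \<in> {0<..}\<close> by (auto intro!: derivative_eq_intros simp: algebra_simps)
    show "0 \<le> p * ((1 - p) * x powr (p - 2))"
      using assms by simp
  qed (use assms in auto)
  moreover have "s powr (p - 1) * s = s powr p"
    using assms by (simp add: powr_mult_base mult.commute)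
  ultimately show ?thesis by (simp add: algebra_simps)
qed

text \<open>Integrates the tangent inequality with exponent \<open>1 - q\<close>. The tangent point
  \<open>s\<close> stays free: the number of cells is the right choice for the sum over a grid, the
  reciprocal measure of \<open>A\<close>, its mean return time, for a single cell.\<close>

lemma vnk_cell_pow_lower:
  assumes "A \<in> sets unit_lebesgue" "u < v" "{u..v} \<subseteq> A" "q \<le> 0 \<or> 1 \<le> q" "0 < s"
  shows "ennreal (q * s powr (1 - q) * measure unit_lebesgue A + (1 - q) * s powr (- q))
    \<le> (\<integral>\<^sup>+x\<in>A. return_pow vnk q A x \<partial>unit_lebesgue)"
proof -
  have "ennreal (q * s powr (1 - q) * measure unit_lebesgue A + (1 - q) * s powr (- q) * 1)
    \<le> (\<integral>\<^sup>+x\<in>A. return_pow vnk q A x \<partial>unit_lebesgue)"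
  proof (rule return_time_affine_lower[OF unit_lebesgue.finite_measure_axioms measurable_vnk_unit assms(1)])
    fix x m assume m: "return_time vnk A x = enat m"
    then have "0 < real m" using return_time_eq_SucD by simp
    from powr_tangent_below[OF assms(5) this, of "1 - q"] assms(4)
    show "ennreal (q * s powr (1 - q) + (1 - q) * s powr (- q) * real m) \<le> return_pow vnk q A x"
      by (auto simp: return_pow_eq[OF m] intro!: ennreal_leI)
  qed (use vnk_kac[OF assms(1-3)] in auto)
  then show ?thesis by simp
qed

lemma vnk_cell_pow_upper:
  assumes "A \<in> sets unit_lebesgue" "u < v" "{u..v} \<subseteq> A" "0 \<le> q" "q \<le> 1" "0 < s"
  shows "(\<integral>\<^sup>+x\<in>A. return_pow vnk q A x \<partial>unit_lebesgue)
    \<le> ennreal (q * s powr (1 - q) * measure unit_lebesgue A + (1 - q) * s powr (- q))"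
proof -
  have "(\<integral>\<^sup>+x\<in>A. return_pow vnk q A x \<partial>unit_lebesgue)
    \<le> ennreal (q * s powr (1 - q) * measure unit_lebesgue A + (1 - q) * s powr (- q) * 1)"
  proof (rule return_time_affine_upper[OF unit_lebesgue.finite_measure_axioms measurable_vnk_unit assms(1)])
    fix x m assume m: "return_time vnk A x = enat m"
    then have "0 < real m" using return_time_eq_SucD by simp
    from powr_tangent_above[OF assms(6) this, of "1 - q"] assms
    show "return_pow vnk q A x \<le> ennreal (q * s powr (1 - q) + (1 - q) * s powr (- q) * real m)
      \<and> 0 \<le> q * s powr (1 - q) + (1 - q) * s powr (- q) * real m"
      by (auto simp: return_pow_eq[OF m] simp del: ennreal_plus intro!: ennreal_leI)
  qed (use vnk_kac[OF assms(1-3)] in auto)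
  then show ?thesis by simp
qed

text \<open>The same for the logarithm, whose tangent at \<open>s\<close> is
  \<open>ln s - 1 + t / s\<close>.\<close>

lemma vnk_cell_log_upper:
  assumes "A \<in> sets unit_lebesgue" "u < v" "{u..v} \<subseteq> A" "0 < s"
  shows "(\<integral>\<^sup>+x\<in>A. return_log vnk A x \<partial>unit_lebesgue)
    \<le> ennreal ((ln s - 1) * measure unit_lebesgue A + 1 / s)"
proof -
  have "(\<integral>\<^sup>+x\<in>A. return_log vnk A x \<partial>unit_lebesgue)
    \<le> ennreal ((ln s - 1) * measure unit_lebesgue A + 1 / s * 1)"
  proof (rule return_time_affine_upper[OF unit_lebesgue.finite_measure_axioms measurable_vnk_unit assms(1)])
    fix x m assume m: "return_time vnk A x = enat m"
    then have m1: "1 \<le> real m" using return_time_eq_SucD[of vnk A x m] by simp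
    have "ln (real m / s) \<le> real m / s - 1"
      using m1 assms(4) by (intro ln_le_minus_one) auto
    then have "ln (real m) \<le> ln s - 1 + 1 / s * real m"
      using m1 assms(4) by (simp add: ln_div)
    moreover have "0 \<le> ln (real m)" using m1 by simp
    ultimately show "return_log vnk A x \<le> ennreal (ln s - 1 + 1 / s * real m)
      \<and> 0 \<le> ln s - 1 + 1 / s * real m"
      by (auto simp: return_log_eq[OF m] intro!: ennreal_leI)
  qed (use vnk_kac[OF assms(1-3)] in auto)
  then show ?thesis by simp
qed

section \<open>Return times to balls\<close>

text \<open>A return in fewer than \<open>2 ^ n\<close> steps changes the dyadic cell of order \<open>n\<close>, so an endpoint of
  such a cell lies between the point and its return.\<close>

definition near_dyadic :: "nat \<Rightarrow> real \<Rightarrow> real set" where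
  "near_dyadic n \<epsilon> = (\<Union>k\<in>{1..<2 ^ n}. {real k / 2 ^ n - \<epsilon> <..< real k / 2 ^ n + \<epsilon>}) \<inter> {0..1}"

lemma near_dyadic_sets: "near_dyadic n \<epsilon> \<in> sets unit_lebesgue"
  by (auto simp: near_dyadic_def sets_unit_lebesgue)

lemma integrable_near_dyadic: "integrable unit_lebesgue (indicat_real (near_dyadic n \<epsilon>))"
  by (rule integrable_real_indicator) (simp_all add: near_dyadic_sets flip: less_top)

lemma near_dyadic_Int [simp]: "near_dyadic n \<epsilon> \<inter> {0..1} = near_dyadic n \<epsilon>"
  by (auto simp: near_dyadic_def)

lemma measure_unit_lebesgue_space [simp]: "measure unit_lebesgue {0..1} = 1"
  by (simp add: measure_def)

lemma near_dyadic_0: "near_dyadic 0 \<epsilon> = {}"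
  by (simp add: near_dyadic_def)

lemma measure_near_dyadic:
  assumes "0 \<le> \<epsilon>"
  shows "measure unit_lebesgue (near_dyadic n \<epsilon>) \<le> 2 ^ (n + 1) * \<epsilon>"
proof -
  let ?B = "\<lambda>k. {real k / 2 ^ n - \<epsilon> <..< real k / 2 ^ n + \<epsilon>}"
  have "emeasure unit_lebesgue (near_dyadic n \<epsilon>) \<le> emeasure lborel (\<Union>k\<in>{1..<2 ^ n}. ?B k)"
    by (subst emeasure_unit_lebesgue) (auto simp: near_dyadic_def intro!: emeasure_mono)
  also have "\<dots> \<le> (\<Sum>k\<in>{1..<2 ^ n}. emeasure lborel (?B k))"
    by (rule emeasure_subadditive_finite) auto
  also have "\<dots> = (\<Sum>k\<in>{1..<2 ^ n :: nat}. ennreal (2 * \<epsilon>))"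
    using assms by (intro sum.cong) auto
  also have "\<dots> = ennreal (real (2 ^ n - 1) * (2 * \<epsilon>))"
    using assms by (simp add: ennreal_mult' ennreal_of_nat_eq_real_of_nat)
  also have "\<dots> \<le> ennreal (2 ^ (n + 1) * \<epsilon>)"
    using assms by (intro ennreal_leI) (auto simp: of_nat_diff algebra_simps)
  finally show ?thesis
    using assms by (simp add: unit_lebesgue.emeasure_eq_measure)
qed

lemma vnk_close_return_near_dyadic:
  assumes "0 \<le> x" "x < 1" "0 < m" "m < 2 ^ n" "\<bar>(vnk ^^ m) x - x\<bar> < \<epsilon>"
  shows "x \<in> near_dyadic n \<epsilon>"
proof -
  let ?y = "(vnk ^^ m) x"
  have y: "0 \<le> ?y" "?y < 1" using vnk_iterate_bounds assms by auto
  have "\<lfloor>2 ^ n * ?y\<rfloor> \<noteq> \<lfloor>2 ^ n * x\<rfloor>"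
    using vnk_iterate_same_cell_iff[of x n m] assms by (auto dest: dvd_imp_le)
  have range: "0 \<le> 2 ^ n * z \<and> 2 ^ n * z < 2 ^ n" if "0 \<le> z" "z < 1" for z :: real
    using that mult_strict_left_mono[of z 1 "2 ^ n"] by simp
  \<comment> \<open>The witness is the left endpoint of the cell of \<open>b\<close>: its index is
    at least 1 because the cell of \<open>a\<close> has a smaller one, and below
    \<open>2 ^ n\<close> because \<open>b < 1\<close>.\<close>
  have between: "\<exists>k. a \<le> real k / 2 ^ n \<and> real k / 2 ^ n \<le> b \<and> k \<in> {1..<2 ^ n}"
    if "0 \<le> a" "b < 1" "0 \<le> b" "\<lfloor>2 ^ n * a\<rfloor> < \<lfloor>2 ^ n * b\<rfloor>" for a b :: real
  proof -
    define k where "k = nat \<lfloor>2 ^ n * b\<rfloor>"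
    have "0 \<le> \<lfloor>2 ^ n * a\<rfloor>" using that by simp
    then have "1 \<le> \<lfloor>2 ^ n * b\<rfloor>" using that by linarith
    then have k: "real k = of_int \<lfloor>2 ^ n * b\<rfloor>" "1 \<le> k" unfolding k_def by linarith+
    have "2 ^ n * a \<le> real k" "real k \<le> 2 ^ n * b" "real k < 2 ^ n"
      using that k range[of b] by linarith+
    moreover from this(3) have "k < 2 ^ n" by simp
    ultimately show ?thesis using k by (intro exI[of _ k]) (auto simp: field_simps)
  qed
  have "\<exists>k\<in>{1..<2 ^ n}. \<bar>x - real k / 2 ^ n\<bar> < \<epsilon>"
  proof (cases "\<lfloor>2 ^ n * x\<rfloor> < \<lfloor>2 ^ n * ?y\<rfloor>")
    case True
    from between[OF assms(1) y(2,1) True] obtain k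
      where "x \<le> real k / 2 ^ n" "real k / 2 ^ n \<le> ?y" "k \<in> {1..<2 ^ n}" by blast
    with assms(5) show ?thesis by (intro bexI[of _ k]) auto
  next
    case False
    with \<open>\<lfloor>2 ^ n * ?y\<rfloor> \<noteq> \<lfloor>2 ^ n * x\<rfloor>\<close> have "\<lfloor>2 ^ n * ?y\<rfloor> < \<lfloor>2 ^ n * x\<rfloor>" by simp
    from between[OF y(1) assms(2,1) this] obtain k
      where "?y \<le> real k / 2 ^ n" "real k / 2 ^ n \<le> x" "k \<in> {1..<2 ^ n}" by blast
    with assms(5) show ?thesis by (intro bexI[of _ k]) auto
  qed
  then obtain k where "k \<in> {1..<2 ^ n}" "\<bar>x - real k / 2 ^ n\<bar> < \<epsilon>" by blast
  with assms(1,2) show ?thesis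
    unfolding near_dyadic_def by (intro IntI UN_I[of k]) (auto simp: abs_less_iff)
qed

lemma ball_return_time_ge:
  assumes "0 \<le> x" "x < 1" "x \<notin> near_dyadic n \<epsilon>"
  shows "enat (2 ^ n) \<le> return_time vnk (ball x \<epsilon> \<inter> {0..1}) x"
proof (rule return_time_ge)
  fix m :: nat assume "0 < m" "m < 2 ^ n"
  with vnk_close_return_near_dyadic[OF assms(1,2) this, of \<epsilon>] assms(3)
  show "(vnk ^^ m) x \<notin> ball x \<epsilon> \<inter> {0..1}"
    by (auto simp: dist_real_def abs_minus_commute)
qed

lemma ball_return_time_le:
  assumes "0 \<le> x" "x < 1" "1 / 2 ^ n \<le> \<epsilon>"
  shows "return_time vnk (ball x \<epsilon> \<inter> {0..1}) x \<le> enat (2 ^ n)"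
proof (rule return_time_le)
  let ?y = "(vnk ^^ (2 ^ n)) x"
  have y: "0 \<le> ?y" "?y < 1" using vnk_iterate_bounds assms by auto
  have "\<lfloor>2 ^ n * ?y\<rfloor> = \<lfloor>2 ^ n * x\<rfloor>"
    using vnk_iterate_same_cell_iff[OF assms(1,2), of n "2 ^ n"] by simp
  then have "\<bar>2 ^ n * ?y - 2 ^ n * x\<bar> < 1" by linarith
  then have "2 ^ n * \<bar>?y - x\<bar> < 1" by (simp add: abs_mult flip: right_diff_distrib)
  then have "\<bar>?y - x\<bar> < 1 / 2 ^ n" by (simp add: field_simps)
  with assms(3) y show "?y \<in> ball x \<epsilon> \<inter> {0..1}"
    by (auto simp: dist_real_def abs_minus_commute)
qed simp

text \<open>Points close to 1 are sent close to 0: on \<open>vnk_piece k\<close> the distance to 1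
  exceeds \<open>1 / 2 ^ (k + 1)\<close>, while the image stays below
  \<open>1 / 2 ^ k\<close>.\<close>

lemma vnk_less_2:
  assumes "0 \<le> y" "y < 1"
  shows "vnk y < 2 * (1 - y)"
proof -
  obtain k where k: "y \<in> vnk_piece k" using vnk_piece_exists assms by blast
  define c :: real where "c = 1 / 2 ^ k"
  have "y < 1 - c / 2" using k by (auto simp: vnk_piece_def c_def)
  moreover have "vnk y < c" using vnk_bounds_piece(2)[OF k] by (simp add: c_def)
  ultimately have "vnk y < 2 - 2 * y" by linarith
  then show ?thesis by simp
qed

text \<open>With t = 1/2 - x, the third iterate is 1/2 + \<open>vnk (2 * x) / 2\<close>, and
  \<open>vnk_less_2\<close> bounds the last term by 2 t. So it is within t + 2 t = 3 t of
  \<open>x\<close>, whence the width \<open>\<epsilon> / 3\<close>. The bound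
  \<open>\<epsilon> \<le> 1\<close> keeps \<open>x\<close> in the unit interval.\<close>

lemma ball_return_time_near_half:
  assumes "1/2 - \<epsilon> / 3 < x" "x < 1/2" "\<epsilon> \<le> 1"
  shows "return_time vnk (ball x \<epsilon> \<inter> {0..1}) x \<le> enat 3"
proof (rule return_time_le)
  have x: "0 \<le> x" using assms by simp
  have 1: "vnk x = x + 1/2" using x assms by (intro vnk_lower_half) auto
  have 2: "vnk (x + 1/2) = vnk (2 * x) / 2" using x assms vnk_upper_half[of "x + 1/2"] by simp
  have 3: "vnk (vnk (2 * x) / 2) = vnk (2 * x) / 2 + 1/2"
    using vnk_bounds[of "2 * x"] by (intro vnk_lower_half) auto
  have "(vnk ^^ 3) x = vnk (2 * x) / 2 + 1/2"
    by (simp add: numeral_3_eq_3 1 2 3)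
  moreover have "vnk (2 * x) < 2 * (1 - 2 * x)" using x assms by (intro vnk_less_2) auto
  ultimately show "(vnk ^^ 3) x \<in> ball x \<epsilon> \<inter> {0..1}"
    using assms vnk_bounds[of "2 * x"] by (auto simp: dist_real_def)
qed simp

section \<open>Bounds on the integrals over balls\<close>

lemma Gamma_tau_unit:
  "Gamma_tau unit_lebesgue vnk \<epsilon> q = (\<integral>\<^sup>+x. return_pow vnk q (ball x \<epsilon> \<inter> {0..1}) x \<partial>unit_lebesgue)"
  by (simp add: Gamma_tau_def)

abbreviation Gamma_log_integral :: "real \<Rightarrow> ennreal" where
  "Gamma_log_integral \<epsilon> \<equiv> (\<integral>\<^sup>+x. return_log vnk (ball x \<epsilon> \<inter> {0..1}) x \<partial>unit_lebesgue)"

lemma nn_integral_unit_lebesgue_le: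
  assumes "\<And>x. 0 \<le> x \<Longrightarrow> x < 1 \<Longrightarrow> f x \<le> g x"
  shows "(\<integral>\<^sup>+x. f x \<partial>unit_lebesgue) \<le> (\<integral>\<^sup>+x. g x \<partial>unit_lebesgue)"
  by (rule nn_integral_mono_AE) (use AE_unit_lebesgue in eventually_elim, use assms in auto)

lemma Gamma_tau_le:
  assumes "q \<le> 1" "1 / 2 ^ n \<le> \<epsilon>"
  shows "Gamma_tau unit_lebesgue vnk \<epsilon> q \<le> ennreal ((2 ^ n) powr (1 - q))"
proof -
  have "Gamma_tau unit_lebesgue vnk \<epsilon> q \<le> (\<integral>\<^sup>+x. ennreal (real (2 ^ n) powr (1 - q)) \<partial>unit_lebesgue)"
    unfolding Gamma_tau_unit
    by (intro nn_integral_unit_lebesgue_le return_pow_le_upper ball_return_time_le assms) auto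
  then show ?thesis by simp
qed

lemma Gamma_tau_ge:
  assumes "1 \<le> q" "1 / 2 ^ n \<le> \<epsilon>"
  shows "ennreal ((2 ^ n) powr (1 - q)) \<le> Gamma_tau unit_lebesgue vnk \<epsilon> q"
proof -
  have "(\<integral>\<^sup>+x. ennreal (real (2 ^ n) powr (1 - q)) \<partial>unit_lebesgue) \<le> Gamma_tau unit_lebesgue vnk \<epsilon> q"
    unfolding Gamma_tau_unit
    by (intro nn_integral_unit_lebesgue_le return_pow_ge_upper ball_return_time_le assms) auto
  then show ?thesis by simp
qed

lemma Gamma_log_integral_le:
  assumes "1 / 2 ^ n \<le> \<epsilon>"
  shows "Gamma_log_integral \<epsilon> \<le> ennreal (ln (2 ^ n))"
proof -
  have "Gamma_log_integral \<epsilon> \<le> (\<integral>\<^sup>+x. ennreal (ln (real (2 ^ n))) \<partial>unit_lebesgue)"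
    by (intro nn_integral_unit_lebesgue_le return_log_le ball_return_time_le assms) auto
  then show ?thesis by simp
qed

lemma Gamma_tau_ge_half:
  assumes "1 \<le> q" "0 < \<epsilon>" "\<epsilon> \<le> 1"
  shows "ennreal (3 powr (1 - q) * (\<epsilon> / 3)) \<le> Gamma_tau unit_lebesgue vnk \<epsilon> q"
proof -
  let ?H = "{1/2 - \<epsilon> / 3 <..< 1/2}"
  have "ennreal (3 powr (1 - q) * (\<epsilon> / 3)) = ennreal (3 powr (1 - q)) * emeasure unit_lebesgue ?H"
    using assms by (subst emeasure_unit_lebesgue) (auto simp flip: ennreal_mult')
  also have "\<dots> = (\<integral>\<^sup>+x. ennreal (3 powr (1 - q)) * indicator ?H x \<partial>unit_lebesgue)"
    using assms by (intro nn_integral_cmult_indicator[symmetric]) (auto simp: sets_unit_lebesgue)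
  also have "\<dots> \<le> Gamma_tau unit_lebesgue vnk \<epsilon> q"
    unfolding Gamma_tau_unit
  proof (rule nn_integral_unit_lebesgue_le)
    fix x :: real
    show "ennreal (3 powr (1 - q)) * indicator ?H x \<le> return_pow vnk q (ball x \<epsilon> \<inter> {0..1}) x"
      using return_pow_ge_upper[OF assms(1) ball_return_time_near_half[of \<epsilon> x]] assms
      by (auto simp: indicator_def)
  qed
  finally show ?thesis .
qed

text \<open>Keeps only the points away from the endpoints of order \<open>n\<close>. The bound is
  informative as long as \<open>2 ^ (n + 1) * \<epsilon>\<close> is below 1, so \<open>2 ^ n\<close>
  has to be chosen a constant factor below \<open>1 / \<epsilon>\<close>.\<close>

lemma Gamma_tau_ge_power:
  assumes "q \<le> 1" "0 < \<epsilon>"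
  shows "ennreal ((2 ^ n) powr (1 - q) * (1 - 2 ^ (n + 1) * \<epsilon>)) \<le> Gamma_tau unit_lebesgue vnk \<epsilon> q"
proof -
  let ?E = "{0..1} - near_dyadic n \<epsilon>"
  have [measurable]: "near_dyadic n \<epsilon> \<in> sets unit_lebesgue" by (rule near_dyadic_sets)
  have E: "?E \<in> sets unit_lebesgue" using sets.compl_sets[OF near_dyadic_sets] by simp
  have "measure unit_lebesgue ?E = 1 - measure unit_lebesgue (near_dyadic n \<epsilon>)"
    using unit_lebesgue.finite_measure_compl[OF near_dyadic_sets[of n \<epsilon>]]
    by (simp add: measure_def)
  then have "1 - 2 ^ (n + 1) * \<epsilon> \<le> measure unit_lebesgue ?E"
    using measure_near_dyadic[of \<epsilon> n] assms by simp
  then have "ennreal ((2 ^ n) powr (1 - q) * (1 - 2 ^ (n + 1) * \<epsilon>)) \<le>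
      ennreal ((2 ^ n) powr (1 - q) * measure unit_lebesgue ?E)"
    by (intro ennreal_leI mult_left_mono) auto
  also have "\<dots> = (\<integral>\<^sup>+x. ennreal ((2 ^ n) powr (1 - q)) * indicator ?E x \<partial>unit_lebesgue)"
    using E by (subst nn_integral_cmult_indicator) (auto simp: ennreal_mult unit_lebesgue.emeasure_eq_measure)
  also have "\<dots> \<le> Gamma_tau unit_lebesgue vnk \<epsilon> q"
    unfolding Gamma_tau_unit
  proof (rule nn_integral_unit_lebesgue_le)
    fix x :: real assume "0 \<le> x" "x < 1"
    then show "ennreal ((2 ^ n) powr (1 - q)) * indicator ?E x \<le> return_pow vnk q (ball x \<epsilon> \<inter> {0..1}) x"
      using return_pow_ge_lower[OF assms(1) ball_return_time_ge[of x n \<epsilon>]]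
      by (auto simp: indicator_def)
  qed
  finally show ?thesis .
qed

text \<open>The finest order whose endpoints stay away from \<open>x\<close> guarantees the return
  time \<open>2 ^ j\<close>; membership at all finer orders lets a sum of indicators pay for the
  loss. Order 0 has no endpoints, so \<open>j\<close> exists.\<close>

lemma near_dyadic_level:
  obtains j where "j \<le> n" "x \<notin> near_dyadic j \<epsilon>" "\<And>i. j < i \<Longrightarrow> i \<le> n \<Longrightarrow> x \<in> near_dyadic i \<epsilon>"
proof -
  define j where "j = (GREATEST j. j \<le> n \<and> x \<notin> near_dyadic j \<epsilon>)"
  have "0 \<le> n \<and> x \<notin> near_dyadic 0 \<epsilon>" by (simp add: near_dyadic_0)
  then have j: "j \<le> n \<and> x \<notin> near_dyadic j \<epsilon>"
    unfolding j_def by (rule GreatestI_nat[where b = n]) simp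
  have "x \<in> near_dyadic i \<epsilon>" if "j < i" "i \<le> n" for i
  proof (rule ccontr)
    assume "x \<notin> near_dyadic i \<epsilon>"
    with that have "i \<le> j" unfolding j_def by (intro Greatest_le_nat[where b = n]) auto
    with that show False by simp
  qed
  with j that show ?thesis by blast
qed

text \<open>The logarithm to base 2 of the return time is at least \<open>n\<close> minus the number
  of orders up to \<open>n\<close> at which the point is near an endpoint. The measures of these
  neighbourhoods form a geometric series, so for \<open>2 ^ n\<close> of size
  \<open>1 / \<epsilon>\<close> only a bounded amount is lost.\<close>

lemma Gamma_log_integral_ge:
  assumes "0 < \<epsilon>"
  shows "ennreal ((real n - 2 ^ (n + 2) * \<epsilon>) * ln 2) \<le> Gamma_log_integral \<epsilon>"
proof -
  define h where "h x = (real n - (\<Sum>i\<in>{1..n}. indicator (near_dyadic i \<epsilon>) x)) * ln 2" for x :: real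
  have [measurable]: "near_dyadic i \<epsilon> \<in> sets unit_lebesgue" for i by (rule near_dyadic_sets)
  have h: "integrable unit_lebesgue h"
    "integral\<^sup>L unit_lebesgue h = (real n - (\<Sum>i\<in>{1..n}. measure unit_lebesgue (near_dyadic i \<epsilon>))) * ln 2"
    unfolding h_def by (simp_all add: integrable_near_dyadic)
  have "(\<Sum>i\<in>{1..n}. measure unit_lebesgue (near_dyadic i \<epsilon>)) \<le> (\<Sum>i\<in>{1..n}. 2 ^ (i + 1) * \<epsilon>)"
    using assms by (intro sum_mono measure_near_dyadic) simp
  also have "\<dots> \<le> 2 ^ (n + 2) * \<epsilon>"
    using assms by (induction n) (auto simp: algebra_simps)
  finally have "ennreal ((real n - 2 ^ (n + 2) * \<epsilon>) * ln 2) \<le> ennreal (integral\<^sup>L unit_lebesgue h)"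
    unfolding h by (intro ennreal_leI mult_right_mono) auto
  also have "\<dots> \<le> (\<integral>\<^sup>+x. ennreal (h x) \<partial>unit_lebesgue)"
    by (rule ennreal_integral_le_nn_integral) (rule h)
  also have "\<dots> \<le> Gamma_log_integral \<epsilon>"
  proof (rule nn_integral_unit_lebesgue_le)
    fix x :: real assume x: "0 \<le> x" "x < 1"
    obtain j where j: "j \<le> n" "x \<notin> near_dyadic j \<epsilon>" "\<And>i. j < i \<Longrightarrow> i \<le> n \<Longrightarrow> x \<in> near_dyadic i \<epsilon>"
      using near_dyadic_level[of n x \<epsilon>] by blast
    have "real n - real j = (\<Sum>i\<in>{j<..n}. indicator (near_dyadic i \<epsilon>) x)"
      using j by (simp add: of_nat_diff)
    also have "\<dots> \<le> (\<Sum>i\<in>{1..n}. indicator (near_dyadic i \<epsilon>) x)"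
      by (intro sum_mono2) auto
    finally have "h x \<le> real j * ln 2" unfolding h_def by (intro mult_right_mono) auto
    then have "ennreal (h x) \<le> ennreal (ln (real (2 ^ j)))"
      by (intro ennreal_leI) (simp add: ln_realpow)
    also have "\<dots> \<le> return_log vnk (ball x \<epsilon> \<inter> {0..1}) x"
      using x j by (intro return_log_ge ball_return_time_ge) auto
    finally show "ennreal (h x) \<le> return_log vnk (ball x \<epsilon> \<inter> {0..1}) x" .
  qed
  finally show ?thesis .
qed

text \<open>A point whose level \<open>j\<close> is below \<open>n\<close> lies in the neighbourhood
  of order \<open>Suc j\<close>, so the term \<open>i = j\<close> of \<open>h\<close> covers it.
  Integrated, term \<open>i\<close> is at most \<open>4 * \<epsilon> * (2 ^ i) powr (2 - q)\<close>;
  for \<open>q \<le> 2\<close> this is largest at the finest scale, and \<open>n\<close> such terms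
  give the factor \<open>real n\<close>.\<close>

lemma Gamma_tau_le_power:
  assumes "1 \<le> q" "q \<le> 2" "0 < \<epsilon>"
  shows "Gamma_tau unit_lebesgue vnk \<epsilon> q \<le> ennreal ((2 ^ n) powr (1 - q) * (1 + 4 * real n * 2 ^ n * \<epsilon>))"
proof -
  define h where "h x = (2 ^ n) powr (1 - q) + (\<Sum>i<n. (2 ^ i) powr (1 - q) * indicator (near_dyadic (Suc i) \<epsilon>) x)" for x :: real
  have [measurable]: "near_dyadic i \<epsilon> \<in> sets unit_lebesgue" for i by (rule near_dyadic_sets)
  have h: "integrable unit_lebesgue h"
    "integral\<^sup>L unit_lebesgue h = (2 ^ n) powr (1 - q) + (\<Sum>i<n. (2 ^ i) powr (1 - q) * measure unit_lebesgue (near_dyadic (Suc i) \<epsilon>))"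
    unfolding h_def by (simp_all add: integrable_near_dyadic del: sum_mult_indicator)
  have h0: "0 \<le> h x" for x
    unfolding h_def by (intro add_nonneg_nonneg sum_nonneg) auto
  have "Gamma_tau unit_lebesgue vnk \<epsilon> q \<le> (\<integral>\<^sup>+x. ennreal (h x) \<partial>unit_lebesgue)"
    unfolding Gamma_tau_unit
  proof (rule nn_integral_unit_lebesgue_le)
    fix x :: real assume x: "0 \<le> x" "x < 1"
    obtain j where j: "j \<le> n" "x \<notin> near_dyadic j \<epsilon>" "\<And>i. j < i \<Longrightarrow> i \<le> n \<Longrightarrow> x \<in> near_dyadic i \<epsilon>"
      using near_dyadic_level[of n x \<epsilon>] by blast
    have "return_pow vnk q (ball x \<epsilon> \<inter> {0..1}) x \<le> ennreal (real (2 ^ j) powr (1 - q))"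
      using x j assms by (intro return_pow_le_lower ball_return_time_ge) auto
    also have "\<dots> \<le> ennreal (h x)"
    proof (rule ennreal_leI, cases "j = n")
      case True
      then show "real (2 ^ j) powr (1 - q) \<le> h x" unfolding h_def by (auto intro!: sum_nonneg)
    next
      case False
      with j have "j < n" by simp
      then have "(2 ^ j) powr (1 - q) * indicator (near_dyadic (Suc j) \<epsilon>) x \<le>
          (\<Sum>i<n. (2 ^ i) powr (1 - q) * indicator (near_dyadic (Suc i) \<epsilon>) x :: real)"
        by (intro member_le_sum) auto
      moreover have "x \<in> near_dyadic (Suc j) \<epsilon>" using \<open>j < n\<close> j by auto
      ultimately show "real (2 ^ j) powr (1 - q) \<le> h x"
        unfolding h_def by (simp add: add_increasing)
    qed
    finally show "return_pow vnk q (ball x \<epsilon> \<inter> {0..1}) x \<le> ennreal (h x)" .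
  qed
  also have "\<dots> = ennreal (integral\<^sup>L unit_lebesgue h)"
    using h h0 by (intro nn_integral_eq_integral) auto
  also have "\<dots> \<le> ennreal ((2 ^ n) powr (1 - q) * (1 + 4 * real n * 2 ^ n * \<epsilon>))"
  proof (rule ennreal_leI)
    have pow2: "2 ^ i * (2 ^ i) powr (1 - q) = (2 ^ i) powr (2 - q)" for i :: nat
      using powr_mult_base[of "2 ^ i" "1 - q"] by simp
    have "(2 ^ i) powr (1 - q) * measure unit_lebesgue (near_dyadic (Suc i) \<epsilon>)
        \<le> 4 * \<epsilon> * (2 ^ n) powr (2 - q)" if "i < n" for i
    proof -
      have "(2 ^ i) powr (1 - q) * measure unit_lebesgue (near_dyadic (Suc i) \<epsilon>)
          \<le> (2 ^ i) powr (1 - q) * (2 ^ (Suc i + 1) * \<epsilon>)"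
        using assms by (intro mult_left_mono measure_near_dyadic) auto
      also have "\<dots> = 4 * \<epsilon> * (2 ^ i) powr (2 - q)" by (simp flip: pow2)
      also have "\<dots> \<le> 4 * \<epsilon> * (2 ^ n) powr (2 - q)"
        using assms that by (intro mult_left_mono powr_mono2 power_increasing) auto
      finally show ?thesis .
    qed
    then have "(\<Sum>i<n. (2 ^ i) powr (1 - q) * measure unit_lebesgue (near_dyadic (Suc i) \<epsilon>))
        \<le> (\<Sum>i<n. 4 * \<epsilon> * (2 ^ n) powr (2 - q))"
      by (intro sum_mono) auto
    also have "\<dots> = real n * (4 * \<epsilon> * (2 ^ n) powr (2 - q))" by simp
    finally show "integral\<^sup>L unit_lebesgue h \<le> (2 ^ n) powr (1 - q) * (1 + 4 * real n * 2 ^ n * \<epsilon>)"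
      unfolding h by (simp add: algebra_simps flip: pow2)
  qed
  finally show ?thesis .
qed

text \<open>Return times are at least 1. For \<open>q > 2\<close> this transfers the bound of order
  \<epsilon> log (1/\<epsilon>) from exponent 2.\<close>

lemma Gamma_tau_antimono:
  assumes "2 \<le> q"
  shows "Gamma_tau unit_lebesgue vnk \<epsilon> q \<le> Gamma_tau unit_lebesgue vnk \<epsilon> 2"
  unfolding Gamma_tau_unit
proof (rule nn_integral_mono)
  fix x :: real
  let ?A = "ball x \<epsilon> \<inter> {0..1}"
  show "return_pow vnk q ?A x \<le> return_pow vnk 2 ?A x"
  proof (cases "return_time vnk ?A x")
    case (enat m)
    then have "1 \<le> real m" using return_time_eq_SucD[OF enat] by simp
    then have "real m powr (1 - q) \<le> real m powr (1 - 2)"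
      using assms by (intro powr_mono) auto
    then show ?thesis by (simp only: return_pow_eq[OF enat] ennreal_leI)
  qed (use assms in \<open>simp add: return_pow_def epowr_def\<close>)
qed

section \<open>Dimensions from bounds on partition functions\<close>

lemma dim_quotient_eq:
  assumes "q \<noteq> 1" "0 < \<epsilon>" "\<epsilon> < 1"
  shows "dim_quotient Z L q \<epsilon> = eln (Z \<epsilon> q) * ereal (1 / ((q - 1) * ln \<epsilon>))"
proof -
  have "ln \<epsilon> \<noteq> 0" using assms by simp
  then have "eln (Z \<epsilon> q) / ereal (ln \<epsilon>) = eln (Z \<epsilon> q) * ereal (1 / ln \<epsilon>)"
    by (simp add: divide_ereal_def inverse_eq_divide)
  then have "dim_quotient Z L q \<epsilon> = eln (Z \<epsilon> q) * (ereal (1 / (q - 1)) * ereal (1 / ln \<epsilon>))"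
    using assms(1) by (simp add: dim_quotient_def mult_ac)
  then show ?thesis by simp
qed

lemma ereal_mult_right_antimono:
  fixes a b :: ereal
  assumes "a \<le> b" "c \<le> 0"
  shows "b * ereal c \<le> a * ereal c"
proof -
  have "x * ereal (- c) = - (x * ereal c)" for x
    by (metis ereal_mult_minus_right uminus_ereal.simps(1))
  with ereal_mult_right_mono[OF assms(1), of "ereal (- c)"] assms(2) show ?thesis by simp
qed

text \<open>For \<open>\<epsilon> < 1\<close> the denominator \<open>(q - 1) * ln \<epsilon>\<close>
  is positive if \<open>q < 1\<close> and negative if \<open>q > 1\<close>, so the partition
  function has to be bounded from above in the first case and from below in the second.\<close>

lemma dim_quotient_le:
  assumes "0 < \<epsilon>" "\<epsilon> < 1" "0 < u"
    and "q < 1 \<and> Z \<epsilon> q \<le> ennreal u \<or> 1 < q \<and> ennreal u \<le> Z \<epsilon> q"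
  shows "dim_quotient Z L q \<epsilon> \<le> ereal (ln u / ((q - 1) * ln \<epsilon>))"
  using assms(4)
proof
  assume *: "q < 1 \<and> Z \<epsilon> q \<le> ennreal u"
  then have "eln (Z \<epsilon> q) \<le> ereal (ln u)" using eln_mono eln_ennreal[OF assms(3)] by metis
  moreover have "0 \<le> (q - 1) * ln \<epsilon>" using * assms by (simp add: mult_nonpos_nonpos)
  ultimately show ?thesis
    using ereal_mult_right_mono[of "eln (Z \<epsilon> q)" "ereal (ln u)" "ereal (1 / ((q - 1) * ln \<epsilon>))"] * assms
    by (subst dim_quotient_eq) auto
next
  assume *: "1 < q \<and> ennreal u \<le> Z \<epsilon> q"
  then have "ereal (ln u) \<le> eln (Z \<epsilon> q)" using eln_mono eln_ennreal[OF assms(3)] by metis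
  moreover have "(q - 1) * ln \<epsilon> \<le> 0" using * assms by (simp add: mult_nonneg_nonpos)
  ultimately show ?thesis
    using ereal_mult_right_antimono[of "ereal (ln u)" "eln (Z \<epsilon> q)" "1 / ((q - 1) * ln \<epsilon>)"] * assms
    by (subst dim_quotient_eq) (auto simp: divide_nonneg_nonpos)
qed

lemma dim_quotient_ge:
  assumes "0 < \<epsilon>" "\<epsilon> < 1" "0 < u"
    and "q < 1 \<and> ennreal u \<le> Z \<epsilon> q \<or> 1 < q \<and> Z \<epsilon> q \<le> ennreal u"
  shows "ereal (ln u / ((q - 1) * ln \<epsilon>)) \<le> dim_quotient Z L q \<epsilon>"
  using assms(4)
proof
  assume *: "q < 1 \<and> ennreal u \<le> Z \<epsilon> q"
  then have "ereal (ln u) \<le> eln (Z \<epsilon> q)" using eln_mono eln_ennreal[OF assms(3)] by metis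
  moreover have "0 \<le> (q - 1) * ln \<epsilon>" using * assms by (simp add: mult_nonpos_nonpos)
  ultimately show ?thesis
    using ereal_mult_right_mono[of "ereal (ln u)" "eln (Z \<epsilon> q)" "ereal (1 / ((q - 1) * ln \<epsilon>))"] * assms
    by (subst dim_quotient_eq) auto
next
  assume *: "1 < q \<and> Z \<epsilon> q \<le> ennreal u"
  then have "eln (Z \<epsilon> q) \<le> ereal (ln u)" using eln_mono eln_ennreal[OF assms(3)] by metis
  moreover have "(q - 1) * ln \<epsilon> \<le> 0" using * assms by (simp add: mult_nonneg_nonpos)
  ultimately show ?thesis
    using ereal_mult_right_antimono[of "eln (Z \<epsilon> q)" "ereal (ln u)" "1 / ((q - 1) * ln \<epsilon>)"] * assms
    by (subst dim_quotient_eq) (auto simp: divide_nonneg_nonpos)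
qed

lemma dim_quotient_1_eq:
  assumes "0 < \<epsilon>" "\<epsilon> < 1" "L \<epsilon> = - enn2ereal I"
  shows "dim_quotient Z L 1 \<epsilon> = enn2ereal I * ereal (1 / - ln \<epsilon>)"
proof -
  have "ln \<epsilon> \<noteq> 0" using assms by simp
  then have "- enn2ereal I / ereal (ln \<epsilon>) = - enn2ereal I * ereal (1 / ln \<epsilon>)"
    by (simp add: divide_ereal_def inverse_eq_divide)
  then show ?thesis
    using assms by (simp add: dim_quotient_def flip: uminus_ereal.simps(1))
qed

lemma dim_quotient_1_le:
  assumes "0 < \<epsilon>" "\<epsilon> < 1" "L \<epsilon> = - enn2ereal I" "I \<le> ennreal u" "0 \<le> u"
  shows "dim_quotient Z L 1 \<epsilon> \<le> ereal (u / - ln \<epsilon>)"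
proof -
  have "enn2ereal I \<le> ereal u"
    using assms(4,5) by (simp add: less_eq_ennreal.rep_eq enn2ereal_ennreal)
  then show ?thesis
    using ereal_mult_right_mono[of "enn2ereal I" "ereal u" "ereal (1 / - ln \<epsilon>)"] assms(1,2)
    by (subst dim_quotient_1_eq[where L = L, OF assms(1-3)]) (auto simp: divide_nonneg_neg)
qed

lemma dim_quotient_1_ge:
  assumes "0 < \<epsilon>" "\<epsilon> < 1" "L \<epsilon> = - enn2ereal I" "ennreal u \<le> I"
  shows "ereal (u / - ln \<epsilon>) \<le> dim_quotient Z L 1 \<epsilon>"
proof -
  have "ereal u \<le> enn2ereal I"
    using assms(4) by (cases "0 \<le> u")
      (auto simp: less_eq_ennreal.rep_eq enn2ereal_ennreal intro: order_trans[OF _ enn2ereal_nonneg])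
  then show ?thesis
    using ereal_mult_right_mono[of "ereal u" "enn2ereal I" "ereal (1 / - ln \<epsilon>)"] assms(1,2)
    by (subst dim_quotient_1_eq[where L = L, OF assms(1-3)]) (auto simp: divide_nonneg_neg)
qed

text \<open>The normalisation by \<open>(q - 1) ln \<epsilon>\<close> turns the bound \<open>b powr (1 - q)\<close>, in the direction
  appropriate to the sign of \<open>1 - q\<close>, into the same bound for all \<open>q\<close>.\<close>

lemma dim_quotient_le_base:
  assumes "0 < \<epsilon>" "\<epsilon> < 1" "1 \<le> b" "L \<epsilon> = - enn2ereal I"
    and "q < 1 \<Longrightarrow> Z \<epsilon> q \<le> ennreal (b powr (1 - q))"
    and "1 < q \<Longrightarrow> ennreal (b powr (1 - q)) \<le> Z \<epsilon> q"
    and "q = 1 \<Longrightarrow> I \<le> ennreal (ln b)"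
  shows "dim_quotient Z L q \<epsilon> \<le> ereal (ln b / - ln \<epsilon>)"
proof (cases "q = 1")
  case True
  then show ?thesis using assms dim_quotient_1_le[where L = L, OF assms(1,2,4), of "ln b" Z] by simp
next
  case False
  then have "q < 1 \<or> 1 < q" by linarith
  then have "dim_quotient Z L q \<epsilon> \<le> ereal (ln (b powr (1 - q)) / ((q - 1) * ln \<epsilon>))"
    using assms by (intro dim_quotient_le) auto
  also have "ln (b powr (1 - q)) / ((q - 1) * ln \<epsilon>) = ln b / - ln \<epsilon>"
    using False assms by (simp add: ln_powr field_simps)
  finally show ?thesis .
qed

lemma dim_quotient_ge_base:
  assumes "0 < \<epsilon>" "\<epsilon> < 1" "1 \<le> b" "L \<epsilon> = - enn2ereal I"
    and "q < 1 \<Longrightarrow> ennreal (b powr (1 - q)) \<le> Z \<epsilon> q"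
    and "1 < q \<Longrightarrow> Z \<epsilon> q \<le> ennreal (b powr (1 - q))"
    and "q = 1 \<Longrightarrow> ennreal (ln b) \<le> I"
  shows "ereal (ln b / - ln \<epsilon>) \<le> dim_quotient Z L q \<epsilon>"
proof (cases "q = 1")
  case True
  then show ?thesis using assms dim_quotient_1_ge[where L = L, OF assms(1,2,4), of "ln b" Z] by simp
next
  case False
  then have "q < 1 \<or> 1 < q" by linarith
  then have "ereal (ln (b powr (1 - q)) / ((q - 1) * ln \<epsilon>)) \<le> dim_quotient Z L q \<epsilon>"
    using assms by (intro dim_quotient_ge) auto
  also have "ln (b powr (1 - q)) / ((q - 1) * ln \<epsilon>) = ln b / - ln \<epsilon>"
    using False assms by (simp add: ln_powr field_simps)
  finally show ?thesis .
qed

lemma dyadic_scale: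
  fixes \<epsilon> :: real
  assumes "0 < \<epsilon>" "\<epsilon> \<le> 1"
  obtains n :: nat where "1 / \<epsilon> \<le> 2 ^ n" "2 ^ n \<le> 2 / \<epsilon>"
proof -
  let ?P = "\<lambda>n. 1 / \<epsilon> \<le> (2::real) ^ n"
  obtain m where "1 / \<epsilon> < (2::real) ^ m" using real_arch_pow[of 2 "1 / \<epsilon>"] by auto
  then have "?P m" by simp
  define n where "n = (LEAST n. ?P n)"
  have "?P n" unfolding n_def using \<open>?P m\<close> by (rule LeastI)
  moreover have "2 ^ n \<le> 2 / \<epsilon>"
  proof (cases n)
    case (Suc k)
    then have "\<not> ?P k" using not_less_Least[of k ?P] unfolding n_def by simp
    then show ?thesis using Suc by simp
  qed (use assms in \<open>simp add: field_simps\<close>)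
  ultimately show ?thesis using that by blast
qed

lemma eventually_at_right_unit:
  assumes "0 < (c::real)" "\<And>\<epsilon>. 0 < \<epsilon> \<Longrightarrow> \<epsilon> < c \<Longrightarrow> P \<epsilon>"
  shows "eventually P (at_right 0)"
  using assms by (auto simp: eventually_at_right_field)

section \<open>Limits of the dimension quotients for balls\<close>

abbreviation Gamma_dim_quotient :: "real \<Rightarrow> real \<Rightarrow> ereal" where
  "Gamma_dim_quotient \<equiv> dim_quotient (Gamma_tau unit_lebesgue vnk) (Gamma_tau_log unit_lebesgue vnk)"

lemma Gamma_tau_log_unit: "Gamma_tau_log unit_lebesgue vnk \<epsilon> = - enn2ereal (Gamma_log_integral \<epsilon>)"
  by (simp add: Gamma_tau_log_def)

lemma Gamma_dim_quotient_le:
  assumes "0 < \<epsilon>" "\<epsilon> < 1"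
  shows "Gamma_dim_quotient q \<epsilon> \<le> ereal (ln (2 / \<epsilon>) / - ln \<epsilon>)"
proof -
  obtain n where n: "1 / \<epsilon> \<le> 2 ^ n" "2 ^ n \<le> 2 / \<epsilon>"
    using dyadic_scale[of \<epsilon>] assms by auto
  then have "1 / 2 ^ n \<le> \<epsilon>" using assms by (simp add: field_simps)
  note bounds = Gamma_tau_le[OF _ this, of q] Gamma_tau_ge[OF _ this, of q] Gamma_log_integral_le[OF this]
  have "Gamma_dim_quotient q \<epsilon> \<le> ereal (ln (2 ^ n) / - ln \<epsilon>)"
    using assms bounds by (intro dim_quotient_le_base[OF _ _ _ Gamma_tau_log_unit]) auto
  also have "\<dots> \<le> ereal (ln (2 / \<epsilon>) / - ln \<epsilon>)"
  proof -
    have "ln (2 ^ n) \<le> ln (2 / \<epsilon>)" using n assms by (subst ln_le_cancel_iff) auto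
    then have "ln (2 ^ n) / - ln \<epsilon> \<le> ln (2 / \<epsilon>) / - ln \<epsilon>"
      using assms by (intro divide_right_mono) auto
    then show ?thesis by simp
  qed
  finally show ?thesis .
qed

lemma Gamma_dim_quotient_ge_less_1:
  assumes "0 < \<epsilon>" "\<epsilon> < 1/8" "q < 1"
  shows "ereal (((1 - q) * ln (1 / (8 * \<epsilon>)) - ln 2) / ((q - 1) * ln \<epsilon>)) \<le> Gamma_dim_quotient q \<epsilon>"
proof -
  \<comment> \<open>The scale \<open>8 * \<epsilon>\<close> yields
    \<open>2 ^ (n + 1) * \<epsilon> \<le> 1/2\<close>, so at least half of the unit interval is away
    from the endpoints.\<close>
  obtain n where n: "1 / (8 * \<epsilon>) \<le> 2 ^ n" "2 ^ n \<le> 2 / (8 * \<epsilon>)"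
    using dyadic_scale[of "8 * \<epsilon>"] assms by auto
  have "2 ^ (n + 1) * \<epsilon> \<le> 1/2" using n(2) assms by (simp add: field_simps)
  then have "(1 / (8 * \<epsilon>)) powr (1 - q) * (1/2) \<le> (2 ^ n) powr (1 - q) * (1 - 2 ^ (n + 1) * \<epsilon>)"
    using n assms by (intro mult_mono powr_mono2) auto
  then have "ennreal ((1 / (8 * \<epsilon>)) powr (1 - q) * (1/2)) \<le> Gamma_tau unit_lebesgue vnk \<epsilon> q"
    using Gamma_tau_ge_power[of q \<epsilon> n] assms by (meson ennreal_leI less_imp_le order_trans)
  then have "ereal (ln ((1 / (8 * \<epsilon>)) powr (1 - q) * (1/2)) / ((q - 1) * ln \<epsilon>)) \<le> Gamma_dim_quotient q \<epsilon>"
    using assms by (intro dim_quotient_ge) auto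
  also have "ln ((1 / (8 * \<epsilon>)) powr (1 - q) * (1/2)) = (1 - q) * ln (1 / (8 * \<epsilon>)) - ln 2"
    using assms by (subst ln_mult) (auto simp: ln_powr ln_div)
  finally show ?thesis .
qed

lemma Gamma_dim_quotient_ge_1:
  assumes "0 < \<epsilon>" "\<epsilon> < 1"
  shows "ereal ((ln (1 / \<epsilon>) - 8 * ln 2) / - ln \<epsilon>) \<le> Gamma_dim_quotient 1 \<epsilon>"
proof -
  obtain n where n: "1 / \<epsilon> \<le> 2 ^ n" "2 ^ n \<le> 2 / \<epsilon>"
    using dyadic_scale[of \<epsilon>] assms by auto
  have "ln (1 / \<epsilon>) \<le> ln (2 ^ n)" using n assms by (subst ln_le_cancel_iff) auto
  then have "ln (1 / \<epsilon>) \<le> real n * ln 2" by (simp add: ln_realpow)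
  moreover have "2 ^ (n + 2) * \<epsilon> * ln 2 \<le> 8 * ln 2"
    using n(2) assms by (intro mult_right_mono) (auto simp: field_simps)
  ultimately have "ln (1 / \<epsilon>) - 8 * ln 2 \<le> (real n - 2 ^ (n + 2) * \<epsilon>) * ln 2"
    unfolding left_diff_distrib by linarith
  then have "ennreal (ln (1 / \<epsilon>) - 8 * ln 2) \<le> Gamma_log_integral \<epsilon>"
    using Gamma_log_integral_ge[OF assms(1), of n] by (meson ennreal_leI order_trans)
  then show ?thesis
    using assms by (intro dim_quotient_1_ge[OF _ _ Gamma_tau_log_unit])
qed

text \<open>The factor \<open>1 + 8 * ln (2 / \<epsilon>) / ln 2\<close> bounds the count of scales,
  using \<open>2 ^ n * \<epsilon> \<le> 2\<close>; its logarithm is negligible against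
  \<open>ln \<epsilon>\<close>. Capping the exponent at 2 covers \<open>q > 2\<close> as
  well.\<close>

lemma Gamma_dim_quotient_ge_greater_1:
  assumes "0 < \<epsilon>" "\<epsilon> < 1" "1 < q" "q' = min q 2"
  shows "ereal (((q' - 1) * ln \<epsilon> + ln (1 + 8 * ln (2 / \<epsilon>) / ln 2)) / ((q - 1) * ln \<epsilon>)) \<le> Gamma_dim_quotient q \<epsilon>"
proof -
  obtain n where n: "1 / \<epsilon> \<le> 2 ^ n" "2 ^ n \<le> 2 / \<epsilon>"
    using dyadic_scale[of \<epsilon>] assms by auto
  have "ln (2 ^ n) \<le> ln (2 / \<epsilon>)" using n assms by (subst ln_le_cancel_iff) auto
  then have n_le: "real n \<le> ln (2 / \<epsilon>) / ln 2" by (simp add: ln_realpow field_simps)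
  have pos: "0 < 1 + 8 * ln (2 / \<epsilon>) / ln 2" using assms by (intro add_pos_nonneg) auto
  have "Gamma_tau unit_lebesgue vnk \<epsilon> q \<le> Gamma_tau unit_lebesgue vnk \<epsilon> q'"
    using assms Gamma_tau_antimono by (auto simp: min_def)
  also have "\<dots> \<le> ennreal ((2 ^ n) powr (1 - q') * (1 + 4 * real n * 2 ^ n * \<epsilon>))"
    using assms by (intro Gamma_tau_le_power) auto
  also have "\<dots> \<le> ennreal ((1 / \<epsilon>) powr (1 - q') * (1 + 8 * ln (2 / \<epsilon>) / ln 2))"
  proof (intro ennreal_leI mult_mono)
    show "(2 ^ n) powr (1 - q') \<le> (1 / \<epsilon>) powr (1 - q')"
      using n assms by (intro powr_mono2') auto
    have "4 * (real n * (2 ^ n * \<epsilon>)) \<le> 4 * (ln (2 / \<epsilon>) / ln 2 * 2)"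
      using n_le n assms by (intro mult_left_mono mult_mono) (auto simp: field_simps)
    then show "1 + 4 * real n * 2 ^ n * \<epsilon> \<le> 1 + 8 * ln (2 / \<epsilon>) / ln 2"
      by (simp add: mult_ac)
  qed (use assms in auto)
  finally have "ereal (ln ((1 / \<epsilon>) powr (1 - q') * (1 + 8 * ln (2 / \<epsilon>) / ln 2)) / ((q - 1) * ln \<epsilon>))
      \<le> Gamma_dim_quotient q \<epsilon>"
    using assms pos by (intro dim_quotient_ge) auto
  also have "ln ((1 / \<epsilon>) powr (1 - q') * (1 + 8 * ln (2 / \<epsilon>) / ln 2)) =
      (q' - 1) * ln \<epsilon> + ln (1 + 8 * ln (2 / \<epsilon>) / ln 2)"
    using assms pos by (subst ln_mult) (auto simp: ln_powr ln_div algebra_simps)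
  finally show ?thesis .
qed

lemma Gamma_dim_quotient_le_greater_1:
  assumes "0 < \<epsilon>" "\<epsilon> < 1" "1 < q"
  shows "Gamma_dim_quotient q \<epsilon> \<le> ereal (((1 - q) * ln 3 + ln (\<epsilon> / 3)) / ((q - 1) * ln \<epsilon>))"
proof -
  have "Gamma_dim_quotient q \<epsilon> \<le> ereal (ln (3 powr (1 - q) * (\<epsilon> / 3)) / ((q - 1) * ln \<epsilon>))"
    using assms Gamma_tau_ge_half[of q \<epsilon>] by (intro dim_quotient_le) auto
  also have "ln (3 powr (1 - q) * (\<epsilon> / 3)) = (1 - q) * ln 3 + ln (\<epsilon> / 3)"
    using assms by (subst ln_mult) (auto simp: ln_powr)
  finally show ?thesis .
qed

lemma Gamma_dim_quotient_tendsto: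
  "(Gamma_dim_quotient q \<longlongrightarrow> ereal (if q \<le> 2 then 1 else 1 / (q - 1))) (at_right 0)"
proof -
  have squeeze: "(Gamma_dim_quotient q \<longlongrightarrow> ereal l) (at_right 0)"
    if "(f \<longlongrightarrow> l) (at_right 0)" "(g \<longlongrightarrow> l) (at_right 0)"
      "\<And>\<epsilon>. 0 < \<epsilon> \<Longrightarrow> \<epsilon> < 1/8 \<Longrightarrow> ereal (f \<epsilon>) \<le> Gamma_dim_quotient q \<epsilon>"
      "\<And>\<epsilon>. 0 < \<epsilon> \<Longrightarrow> \<epsilon> < 1/8 \<Longrightarrow> Gamma_dim_quotient q \<epsilon> \<le> ereal (g \<epsilon>)" for f g l
    by (rule tendsto_sandwich[of "\<lambda>\<epsilon>. ereal (f \<epsilon>)" _ _ "\<lambda>\<epsilon>. ereal (g \<epsilon>)"])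
      (use that in \<open>auto intro!: eventually_at_right_unit[of "1/8"] tendsto_ereal\<close>)
  have upper: "((\<lambda>\<epsilon>. ln (2 / \<epsilon>) / - ln \<epsilon>) \<longlongrightarrow> (1::real)) (at_right 0)"
    by real_asymp
  consider "q < 1" | "q = 1" | "1 < q" "q \<le> 2" | "2 < q" by linarith
  then show ?thesis
  proof cases
    case 1
    then have "((\<lambda>\<epsilon>. ((1 - q) * ln (1 / (8 * \<epsilon>)) - ln 2) / ((q - 1) * ln \<epsilon>)) \<longlongrightarrow> 1) (at_right 0)"
      by real_asymp
    from squeeze[OF this upper] Gamma_dim_quotient_ge_less_1 Gamma_dim_quotient_le 1
    show ?thesis by simp
  next
    case 2
    have "((\<lambda>\<epsilon>. (ln (1 / \<epsilon>) - 8 * ln 2) / - ln \<epsilon>) \<longlongrightarrow> (1::real)) (at_right 0)"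
      by real_asymp
    from squeeze[OF this upper] Gamma_dim_quotient_ge_1 Gamma_dim_quotient_le 2
    show ?thesis by simp
  next
    case 3
    then have "((\<lambda>\<epsilon>. ((q - 1) * ln \<epsilon> + ln (1 + 8 * ln (2 / \<epsilon>) / ln 2)) / ((q - 1) * ln \<epsilon>)) \<longlongrightarrow> 1) (at_right 0)"
      by real_asymp
    from squeeze[OF this upper] Gamma_dim_quotient_ge_greater_1[of _ q q] Gamma_dim_quotient_le 3
    show ?thesis by simp
  next
    case 4
    \<comment> \<open>Both numerators behave like a single \<open>ln \<epsilon>\<close>: the lower
      bound by the cap \<open>q' = 2\<close>, the upper one by the width
      \<open>\<epsilon> / 3\<close> of the interval left of 1/2.\<close>
    have "((\<lambda>\<epsilon>. 1 / (q - 1) * (((2 - 1) * ln \<epsilon> + ln (1 + 8 * ln (2 / \<epsilon>) / ln 2)) / ln \<epsilon>)) \<longlongrightarrow> 1 / (q - 1) * 1) (at_right 0)"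
      by (intro tendsto_mult_left) real_asymp
    moreover have "((\<lambda>\<epsilon>. 1 / (q - 1) * (((1 - q) * ln 3 + ln (\<epsilon> / 3)) / ln \<epsilon>)) \<longlongrightarrow> 1 / (q - 1) * 1) (at_right 0)"
      using 4 by (intro tendsto_mult_left) real_asymp
    ultimately have "((\<lambda>\<epsilon>. ((2 - 1) * ln \<epsilon> + ln (1 + 8 * ln (2 / \<epsilon>) / ln 2)) / ((q - 1) * ln \<epsilon>)) \<longlongrightarrow> 1 / (q - 1)) (at_right 0)"
      "((\<lambda>\<epsilon>. ((1 - q) * ln 3 + ln (\<epsilon> / 3)) / ((q - 1) * ln \<epsilon>)) \<longlongrightarrow> 1 / (q - 1)) (at_right 0)"
      by simp_all
    from squeeze[OF this] Gamma_dim_quotient_ge_greater_1[of _ q 2] Gamma_dim_quotient_le_greater_1 4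
    show ?thesis by simp
  qed
qed

lemma D_tau_vnk:
  "D_tau_upper unit_lebesgue vnk q = ereal (if q \<le> 2 then 1 else 1 / (q - 1))"
  "D_tau_lower unit_lebesgue vnk q = ereal (if q \<le> 2 then 1 else 1 / (q - 1))"
  using lim_imp_Limsup[OF _ Gamma_dim_quotient_tendsto] lim_imp_Liminf[OF _ Gamma_dim_quotient_tendsto]
  by (auto simp: D_tau_upper_def D_tau_lower_def upper_dim_def lower_dim_def)

section \<open>Return times to grid cells\<close>

text \<open>Position in units of \<epsilon> along the orientation, so that both kinds of half-open
  cells are given by the same floor condition.\<close>

fun grid_coord :: "grid \<Rightarrow> real \<Rightarrow> real \<Rightarrow> real" where
  "grid_coord (a, Rightward) \<epsilon> x = (x - a) / \<epsilon>"
| "grid_coord (a, Leftward) \<epsilon> x = (a - x) / \<epsilon>"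

lemma mem_grid_cell_iff:
  assumes "0 < \<epsilon>"
  shows "x \<in> grid_cell \<theta> \<epsilon> j \<longleftrightarrow> \<lfloor>grid_coord \<theta> \<epsilon> x\<rfloor> = j"
proof -
  obtain a d where \<theta>: "\<theta> = (a, d)" by (cases \<theta>)
  show ?thesis
    using assms by (cases d) (auto simp: \<theta> floor_eq_iff field_simps)
qed

lemma grid_cell_convex:
  assumes "u \<in> grid_cell \<theta> \<epsilon> j" "v \<in> grid_cell \<theta> \<epsilon> j"
  shows "{u..v} \<subseteq> grid_cell \<theta> \<epsilon> j"
proof -
  obtain a d where \<theta>: "\<theta> = (a, d)" by (cases \<theta>)
  show ?thesis using assms by (cases d) (auto simp: \<theta>)
qed

lemma grid_cell_borel [measurable]: "grid_cell \<theta> \<epsilon> j \<in> sets borel"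
proof -
  obtain a d where \<theta>: "\<theta> = (a, d)" by (cases \<theta>)
  show ?thesis by (cases d) (auto simp: \<theta>)
qed

abbreviation unit_cell :: "grid \<Rightarrow> real \<Rightarrow> int \<Rightarrow> real set" where
  "unit_cell \<equiv> cell_in unit_lebesgue"

lemma unit_cell_sets: "unit_cell \<theta> \<epsilon> j \<in> sets unit_lebesgue"
  by (auto simp: cell_in_def sets_unit_lebesgue)

lemma measure_unit_cell_le:
  assumes "0 < \<epsilon>"
  shows "measure unit_lebesgue (unit_cell \<theta> \<epsilon> j) \<le> \<epsilon>"
proof -
  obtain a d where \<theta>: "\<theta> = (a, d)" by (cases \<theta>)
  have "emeasure unit_lebesgue (unit_cell \<theta> \<epsilon> j) \<le> emeasure lborel (grid_cell \<theta> \<epsilon> j)"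
    by (subst emeasure_unit_lebesgue) (auto simp: cell_in_def intro!: emeasure_mono)
  also have "\<dots> = ennreal \<epsilon>"
    using assms by (cases d) (auto simp: \<theta> algebra_simps)
  finally show ?thesis
    using assms by (simp add: unit_lebesgue.emeasure_eq_measure)
qed

definition positive_cells :: "grid \<Rightarrow> real \<Rightarrow> int set" where
  "positive_cells \<theta> \<epsilon> = {j. emeasure unit_lebesgue (unit_cell \<theta> \<epsilon> j) > 0}"

lemma unit_cell_null:
  "j \<notin> positive_cells \<theta> \<epsilon> \<Longrightarrow> unit_cell \<theta> \<epsilon> j \<in> null_sets unit_lebesgue"
  using unit_cell_sets[of \<theta> \<epsilon> j] by (simp add: positive_cells_def null_sets_def)

text \<open>Positive measure forces two distinct points, and cells are convex. Supplies the interval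
  that \<open>vnk_kac\<close> asks for.\<close>

lemma unit_cell_interval:
  assumes "j \<in> positive_cells \<theta> \<epsilon>"
  obtains u v where "u < v" "{u..v} \<subseteq> unit_cell \<theta> \<epsilon> j"
proof -
  let ?A = "unit_cell \<theta> \<epsilon> j"
  have pos: "0 < emeasure lborel ?A"
    using assms by (simp add: positive_cells_def emeasure_unit_lebesgue cell_in_def)
  then obtain u where u: "u \<in> ?A" by (cases "?A = {}") auto
  have "?A \<noteq> {u}" using pos by auto
  with u obtain w where w: "w \<in> ?A" "w \<noteq> u" by blast
  have "{min u w..max u w} \<subseteq> ?A"
    using u w grid_cell_convex[of "min u w" \<theta> \<epsilon> j "max u w"]
    by (auto simp: cell_in_def min_def max_def split: if_splits)
  moreover have "min u w < max u w" using w by auto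
  ultimately show ?thesis using that by blast
qed

text \<open>The coordinates of the unit interval fill an interval of length
  \<open>1 / \<epsilon>\<close> starting at \<open>c\<close>, so their floors take at most
  \<open>1 / \<epsilon> + 2\<close> values.\<close>

lemma
  assumes "0 < \<epsilon>"
  shows finite_positive_cells: "finite (positive_cells \<theta> \<epsilon>)"
    and card_positive_cells_le: "real (card (positive_cells \<theta> \<epsilon>)) \<le> 1 / \<epsilon> + 2"
    and sum_measure_positive_cells:
      "(\<Sum>j\<in>positive_cells \<theta> \<epsilon>. measure unit_lebesgue (unit_cell \<theta> \<epsilon> j)) = 1"
proof -
  define c where "c = min (grid_coord \<theta> \<epsilon> 0) (grid_coord \<theta> \<epsilon> 1)"
  define J where "J = {\<lfloor>c\<rfloor>..\<lfloor>c + 1 / \<epsilon>\<rfloor>}"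
  have "c \<le> grid_coord \<theta> \<epsilon> x \<and> grid_coord \<theta> \<epsilon> x \<le> c + 1 / \<epsilon>" if x: "x \<in> {0..1}" for x
  proof -
    obtain a d where \<theta>: "\<theta> = (a, d)" by (cases \<theta>)
    have "0 \<le> x / \<epsilon>" "x / \<epsilon> \<le> 1 / \<epsilon>" using assms x by (auto intro: divide_right_mono)
    then show ?thesis using assms by (cases d) (auto simp: \<theta> c_def min_def diff_divide_distrib)
  qed
  then have coord: "\<lfloor>grid_coord \<theta> \<epsilon> x\<rfloor> \<in> J" if "x \<in> {0..1}" for x
    using that by (auto simp: J_def intro!: floor_mono)
  have sub: "positive_cells \<theta> \<epsilon> \<subseteq> J"
  proof
    fix j assume "j \<in> positive_cells \<theta> \<epsilon>"
    then obtain x where "x \<in> unit_cell \<theta> \<epsilon> j"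
      by (cases "unit_cell \<theta> \<epsilon> j = {}") (auto simp: positive_cells_def)
    then show "j \<in> J" using coord[of x] assms by (simp add: cell_in_def mem_grid_cell_iff)
  qed
  have J: "finite J" by (simp add: J_def)
  then show fin: "finite (positive_cells \<theta> \<epsilon>)" using sub by (rule rev_finite_subset)
  have "real (card (positive_cells \<theta> \<epsilon>)) \<le> real (card J)"
    using card_mono[OF J sub] by simp
  also have "\<dots> \<le> 1 / \<epsilon> + 2"
  proof -
    have "0 \<le> 1 / \<epsilon>" using assms by simp
    then have "\<lfloor>c\<rfloor> \<le> \<lfloor>c + 1 / \<epsilon>\<rfloor>" by (intro floor_mono) simp
    then have "real (card J) = of_int \<lfloor>c + 1 / \<epsilon>\<rfloor> - of_int \<lfloor>c\<rfloor> + 1"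
      by (simp add: J_def)
    also have "\<dots> \<le> 1 / \<epsilon> + 2" by linarith
    finally show ?thesis .
  qed
  finally show "real (card (positive_cells \<theta> \<epsilon>)) \<le> 1 / \<epsilon> + 2" .
  have "(\<Sum>j\<in>positive_cells \<theta> \<epsilon>. measure unit_lebesgue (unit_cell \<theta> \<epsilon> j)) =
      (\<Sum>j\<in>J. measure unit_lebesgue (unit_cell \<theta> \<epsilon> j))"
    using unit_cell_null by (intro sum.mono_neutral_left J sub) (auto simp: measure_eq_0_null_sets)
  also have "\<dots> = measure unit_lebesgue (\<Union>j\<in>J. unit_cell \<theta> \<epsilon> j)"
    using assms unit_cell_sets[of \<theta> \<epsilon>] J
    by (intro unit_lebesgue.finite_measure_finite_Union[symmetric])
      (auto simp: disjoint_family_on_def cell_in_def mem_grid_cell_iff)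
  also have "(\<Union>j\<in>J. unit_cell \<theta> \<epsilon> j) = {0..1}"
    using coord assms by (auto simp: cell_in_def mem_grid_cell_iff)
  finally show "(\<Sum>j\<in>positive_cells \<theta> \<epsilon>. measure unit_lebesgue (unit_cell \<theta> \<epsilon> j)) = 1" by simp
qed

lemma card_positive_cells_ge:
  assumes "0 < \<epsilon>"
  shows "1 / \<epsilon> \<le> real (card (positive_cells \<theta> \<epsilon>))"
proof -
  have "1 \<le> (\<Sum>j\<in>positive_cells \<theta> \<epsilon>. \<epsilon>)"
    unfolding sum_measure_positive_cells[OF assms, of \<theta>, symmetric]
    by (intro sum_mono measure_unit_cell_le assms)
  then show ?thesis using assms by (simp add: field_simps)
qed

lemma infsum_unit_cells:
  fixes g :: "int \<Rightarrow> real \<Rightarrow> ennreal"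
  assumes "0 < \<epsilon>"
  shows "(\<Sum>\<^sub>\<infinity>j. \<integral>\<^sup>+x\<in>unit_cell \<theta> \<epsilon> j. g j x \<partial>unit_lebesgue) =
    (\<Sum>j\<in>positive_cells \<theta> \<epsilon>. \<integral>\<^sup>+x\<in>unit_cell \<theta> \<epsilon> j. g j x \<partial>unit_lebesgue)"
proof -
  have "(\<Sum>\<^sub>\<infinity>j. \<integral>\<^sup>+x\<in>unit_cell \<theta> \<epsilon> j. g j x \<partial>unit_lebesgue) =
      (\<Sum>\<^sub>\<infinity>j\<in>positive_cells \<theta> \<epsilon>. \<integral>\<^sup>+x\<in>unit_cell \<theta> \<epsilon> j. g j x \<partial>unit_lebesgue)"
    by (rule infsum_cong_neutral) (auto intro: nn_integral_null_set unit_cell_null)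
  then show ?thesis using finite_positive_cells[OF assms] by simp
qed

lemma Upsilon_tau_unit:
  assumes "0 < \<epsilon>"
  shows "Upsilon_tau unit_lebesgue vnk \<theta> \<epsilon> q =
    (\<Sum>j\<in>positive_cells \<theta> \<epsilon>. \<integral>\<^sup>+x\<in>unit_cell \<theta> \<epsilon> j. return_pow vnk q (unit_cell \<theta> \<epsilon> j) x \<partial>unit_lebesgue)"
  unfolding Upsilon_tau_def by (rule infsum_unit_cells[OF assms])

definition Upsilon_log_sum :: "grid \<Rightarrow> real \<Rightarrow> ennreal" where
  "Upsilon_log_sum \<theta> \<epsilon> =
    (\<Sum>\<^sub>\<infinity>j. \<integral>\<^sup>+x\<in>unit_cell \<theta> \<epsilon> j. return_log vnk (unit_cell \<theta> \<epsilon> j) x \<partial>unit_lebesgue)"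

lemma Upsilon_tau_log_unit:
  "Upsilon_tau_log unit_lebesgue vnk \<theta> \<epsilon> = - enn2ereal (Upsilon_log_sum \<theta> \<epsilon>)"
  by (simp add: Upsilon_tau_log_def Upsilon_log_sum_def)

text \<open>Negative terms lower the sum on the left but count as 0 on the right.\<close>

lemma ennreal_sum_le: "ennreal (\<Sum>i\<in>I. f i) \<le> (\<Sum>i\<in>I. ennreal (f i))"
proof (induction I rule: infinite_finite_induct)
  case (insert i I)
  have "ennreal (f i + (\<Sum>i\<in>I. f i)) \<le> ennreal (max 0 (f i) + max 0 (\<Sum>i\<in>I. f i))"
    by (intro ennreal_leI) auto
  also have "\<dots> = ennreal (f i) + ennreal (\<Sum>i\<in>I. f i)"
    by (subst ennreal_plus) (auto simp: max_def ennreal_neg)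
  finally show ?case using insert by (auto intro: order_trans add_left_mono)
qed auto

text \<open>The tangent is taken at \<open>N\<close>, the number of cells of positive measure: these
  cells have total mass 1 and each has Kac integral 1, so \<open>N\<close> is the overall mean
  return time and the tangent lines add up to \<open>N powr (1 - q)\<close>.\<close>

lemma Upsilon_tau_ge:
  assumes "0 < \<epsilon>" "q \<le> 0 \<or> 1 \<le> q"
  shows "ennreal (real (card (positive_cells \<theta> \<epsilon>)) powr (1 - q)) \<le> Upsilon_tau unit_lebesgue vnk \<theta> \<epsilon> q"
proof -
  define N where "N = real (card (positive_cells \<theta> \<epsilon>))"
  let ?m = "\<lambda>j. measure unit_lebesgue (unit_cell \<theta> \<epsilon> j)"
  have N: "0 < N" using card_positive_cells_ge[OF assms(1), of \<theta>] assms(1)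
    unfolding N_def by (smt (verit) divide_pos_pos)
  have "(\<Sum>j\<in>positive_cells \<theta> \<epsilon>. q * N powr (1 - q) * ?m j + (1 - q) * N powr (- q)) =
      q * N powr (1 - q) + (1 - q) * (N * N powr (- q))"
    by (simp add: sum.distrib sum_measure_positive_cells[OF assms(1)] N_def flip: sum_distrib_left)
  also have "N * N powr (- q) = N powr (1 - q)"
    using N powr_mult_base[of N "- q"] by simp
  finally have "ennreal (N powr (1 - q)) =
      ennreal (\<Sum>j\<in>positive_cells \<theta> \<epsilon>. q * N powr (1 - q) * ?m j + (1 - q) * N powr (- q))"
    by (simp add: algebra_simps)
  also have "\<dots> \<le> (\<Sum>j\<in>positive_cells \<theta> \<epsilon>. ennreal (q * N powr (1 - q) * ?m j + (1 - q) * N powr (- q)))"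
    by (rule ennreal_sum_le)
  also have "\<dots> \<le> Upsilon_tau unit_lebesgue vnk \<theta> \<epsilon> q"
    unfolding Upsilon_tau_unit[OF assms(1)]
  proof (rule sum_mono)
    fix j assume "j \<in> positive_cells \<theta> \<epsilon>"
    then obtain u v where "u < v" "{u..v} \<subseteq> unit_cell \<theta> \<epsilon> j" by (rule unit_cell_interval)
    then show "ennreal (q * N powr (1 - q) * ?m j + (1 - q) * N powr (- q)) \<le>
        (\<integral>\<^sup>+x\<in>unit_cell \<theta> \<epsilon> j. return_pow vnk q (unit_cell \<theta> \<epsilon> j) x \<partial>unit_lebesgue)"
      using N assms by (intro vnk_cell_pow_lower unit_cell_sets)
  qed
  finally show ?thesis by (simp add: N_def)
qed

lemma Upsilon_tau_le:
  assumes "0 < \<epsilon>" "0 \<le> q" "q \<le> 1"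
  shows "Upsilon_tau unit_lebesgue vnk \<theta> \<epsilon> q \<le> ennreal (real (card (positive_cells \<theta> \<epsilon>)) powr (1 - q))"
proof -
  define N where "N = real (card (positive_cells \<theta> \<epsilon>))"
  let ?m = "\<lambda>j. measure unit_lebesgue (unit_cell \<theta> \<epsilon> j)"
  have N: "0 < N" using card_positive_cells_ge[OF assms(1), of \<theta>] assms(1)
    unfolding N_def by (smt (verit) divide_pos_pos)
  have "Upsilon_tau unit_lebesgue vnk \<theta> \<epsilon> q \<le>
      (\<Sum>j\<in>positive_cells \<theta> \<epsilon>. ennreal (q * N powr (1 - q) * ?m j + (1 - q) * N powr (- q)))"
    unfolding Upsilon_tau_unit[OF assms(1)]
  proof (rule sum_mono)
    fix j assume "j \<in> positive_cells \<theta> \<epsilon>"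
    then obtain u v where "u < v" "{u..v} \<subseteq> unit_cell \<theta> \<epsilon> j" by (rule unit_cell_interval)
    then show "(\<integral>\<^sup>+x\<in>unit_cell \<theta> \<epsilon> j. return_pow vnk q (unit_cell \<theta> \<epsilon> j) x \<partial>unit_lebesgue) \<le>
        ennreal (q * N powr (1 - q) * ?m j + (1 - q) * N powr (- q))"
      using N assms by (intro vnk_cell_pow_upper unit_cell_sets)
  qed
  also have "\<dots> = ennreal (\<Sum>j\<in>positive_cells \<theta> \<epsilon>. q * N powr (1 - q) * ?m j + (1 - q) * N powr (- q))"
    using assms by (intro sum_ennreal) auto
  also have "(\<Sum>j\<in>positive_cells \<theta> \<epsilon>. q * N powr (1 - q) * ?m j + (1 - q) * N powr (- q)) =
      q * N powr (1 - q) + (1 - q) * (N * N powr (- q))"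
    by (simp add: sum.distrib sum_measure_positive_cells[OF assms(1)] N_def flip: sum_distrib_left)
  also have "N * N powr (- q) = N powr (1 - q)"
    using N powr_mult_base[of N "- q"] by simp
  finally show ?thesis by (simp add: N_def algebra_simps)
qed

lemma Upsilon_log_sum_le:
  assumes "0 < \<epsilon>"
  shows "Upsilon_log_sum \<theta> \<epsilon> \<le> ennreal (ln (real (card (positive_cells \<theta> \<epsilon>))))"
proof -
  define N where "N = real (card (positive_cells \<theta> \<epsilon>))"
  let ?m = "\<lambda>j. measure unit_lebesgue (unit_cell \<theta> \<epsilon> j)"
  have N0: "0 < N" using card_positive_cells_ge[OF assms, of \<theta>] assms
    unfolding N_def by (smt (verit) divide_pos_pos)
  \<comment> \<open>\<open>ennreal\<close> commutes with the sum only for nonnegative terms. Here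
    \<open>ln N - 1 \<ge> - 1 / N\<close>, and the measure of a cell is at most 1.\<close>
  have nonneg: "0 \<le> (ln N - 1) * ?m j + 1 / N" for j
  proof -
    have "- ln N \<le> 1 / N - 1" using ln_le_minus_one[of "1 / N"] N0 by (simp add: ln_div)
    then have "- (1 / N) * ?m j \<le> (ln N - 1) * ?m j" by (intro mult_right_mono) auto
    moreover have "?m j \<le> 1"
      using unit_lebesgue.bounded_measure[of "unit_cell \<theta> \<epsilon> j"] by simp
    then have "1 / N * ?m j \<le> 1 / N * 1" using N0 by (intro mult_left_mono) auto
    ultimately show ?thesis by simp
  qed
  have "Upsilon_log_sum \<theta> \<epsilon> \<le> (\<Sum>j\<in>positive_cells \<theta> \<epsilon>. ennreal ((ln N - 1) * ?m j + 1 / N))"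
    unfolding Upsilon_log_sum_def infsum_unit_cells[OF assms]
  proof (rule sum_mono)
    fix j assume "j \<in> positive_cells \<theta> \<epsilon>"
    then obtain u v where "u < v" "{u..v} \<subseteq> unit_cell \<theta> \<epsilon> j" by (rule unit_cell_interval)
    then show "(\<integral>\<^sup>+x\<in>unit_cell \<theta> \<epsilon> j. return_log vnk (unit_cell \<theta> \<epsilon> j) x \<partial>unit_lebesgue) \<le>
        ennreal ((ln N - 1) * ?m j + 1 / N)"
      using N0 by (intro vnk_cell_log_upper unit_cell_sets)
  qed
  also have "\<dots> = ennreal (\<Sum>j\<in>positive_cells \<theta> \<epsilon>. (ln N - 1) * ?m j + 1 / N)"
    using nonneg by (intro sum_ennreal) auto
  also have "(\<Sum>j\<in>positive_cells \<theta> \<epsilon>. (ln N - 1) * ?m j + 1 / N) = ln N - 1 + N * (1 / N)"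
    by (simp add: sum.distrib sum_measure_positive_cells[OF assms] N_def flip: sum_distrib_left)
  also have "\<dots> = ln N" using N0 by simp
  finally show ?thesis by (simp add: N_def)
qed

abbreviation Upsilon_dim_quotient :: "grid \<Rightarrow> real \<Rightarrow> real \<Rightarrow> ereal" where
  "Upsilon_dim_quotient \<theta> \<equiv> dim_quotient (Upsilon_tau unit_lebesgue vnk \<theta>) (Upsilon_tau_log unit_lebesgue vnk \<theta>)"

lemma Upsilon_dim_quotient_le:
  assumes "0 < \<epsilon>" "\<epsilon> < 1" "0 \<le> q"
  shows "Upsilon_dim_quotient \<theta> q \<epsilon> \<le> ereal (ln (3 / \<epsilon>) / - ln \<epsilon>)"
proof -
  let ?N = "real (card (positive_cells \<theta> \<epsilon>))"
  have "1 < 1 / \<epsilon>" using assms by simp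
  moreover note N = card_positive_cells_ge[OF assms(1), of \<theta>] card_positive_cells_le[OF assms(1), of \<theta>]
  \<comment> \<open>The 3 stems from \<open>1 / \<epsilon> + 2 \<le> 3 / \<epsilon>\<close>, as
    \<open>1 < 1 / \<epsilon>\<close>.\<close>
  ultimately have N1: "1 \<le> ?N" and N3: "?N \<le> 3 / \<epsilon>" by (linarith, simp)
  have "Upsilon_dim_quotient \<theta> q \<epsilon> \<le> ereal (ln ?N / - ln \<epsilon>)"
    using assms N1 Upsilon_tau_le[OF assms(1), of q \<theta>] Upsilon_tau_ge[OF assms(1), of q \<theta>] Upsilon_log_sum_le[OF assms(1), of \<theta>]
    by (intro dim_quotient_le_base[OF _ _ _ Upsilon_tau_log_unit]) auto
  also have "\<dots> \<le> ereal (ln (3 / \<epsilon>) / - ln \<epsilon>)"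
  proof -
    have "ln ?N \<le> ln (3 / \<epsilon>)" using N1 N3 assms by (subst ln_le_cancel_iff) auto
    then have "ln ?N / - ln \<epsilon> \<le> ln (3 / \<epsilon>) / - ln \<epsilon>"
      using assms by (intro divide_right_mono) auto
    then show ?thesis by simp
  qed
  finally show ?thesis .
qed

lemma Upsilon_dim_quotient_ge:
  assumes "0 < \<epsilon>" "\<epsilon> < 1" "q \<le> 0"
  shows "1 \<le> Upsilon_dim_quotient \<theta> q \<epsilon>"
proof -
  let ?N = "real (card (positive_cells \<theta> \<epsilon>))"
  have "(1 / \<epsilon>) powr (1 - q) \<le> ?N powr (1 - q)"
    using assms card_positive_cells_ge[OF assms(1), of \<theta>] by (intro powr_mono2) auto
  then have "ennreal ((1 / \<epsilon>) powr (1 - q)) \<le> Upsilon_tau unit_lebesgue vnk \<theta> \<epsilon> q"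
    using Upsilon_tau_ge[OF assms(1), of q \<theta>] assms by (meson ennreal_leI order_trans)
  then have "ereal (ln (1 / \<epsilon>) / - ln \<epsilon>) \<le> Upsilon_dim_quotient \<theta> q \<epsilon>"
    using assms by (intro dim_quotient_ge_base[OF _ _ _ Upsilon_tau_log_unit]) auto
  moreover have "ln (1 / \<epsilon>) / - ln \<epsilon> = 1" using assms by (simp add: ln_div)
  ultimately show ?thesis by (simp only: one_ereal_def)
qed

section \<open>Limits along sequences of scales, and dyadic grids\<close>

lemma le_Limsup_sequence:
  fixes f :: "'a \<Rightarrow> ereal"
  assumes "filterlim s F sequentially" "(\<lambda>n. f (s n)) \<longlonglongrightarrow> l"
  shows "l \<le> Limsup F f"
proof -
  have "l = Limsup sequentially (\<lambda>n. f (s n))"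
    using assms(2) by (simp add: lim_imp_Limsup)
  also have "\<dots> \<le> Limsup (filtermap s sequentially) f" by (rule Limsup_filtermap_ge)
  also have "\<dots> \<le> Limsup F f"
    unfolding Limsup_def using assms(1)
    by (intro INF_superset_mono) (auto simp: filterlim_def le_filter_def)
  finally show ?thesis .
qed

lemma Liminf_le_sequence:
  fixes f :: "'a \<Rightarrow> ereal"
  assumes "filterlim s F sequentially" "(\<lambda>n. f (s n)) \<longlonglongrightarrow> l"
  shows "Liminf F f \<le> l"
proof -
  have "Liminf F f \<le> Liminf (filtermap s sequentially) f"
    unfolding Liminf_def using assms(1)
    by (intro SUP_subset_mono) (auto simp: filterlim_def le_filter_def)
  also have "\<dots> \<le> Liminf sequentially (\<lambda>n. f (s n))" by (rule Liminf_filtermap_le)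
  also have "\<dots> = l"
    using assms(2) by (simp add: lim_imp_Liminf)
  finally show ?thesis .
qed

text \<open>An integer origin only shifts the index of a dyadic cell by \<open>a * 2 ^ n\<close>, so
  the orbit is in the cell exactly at the multiples of \<open>2 ^ n\<close>.\<close>

lemma return_time_dyadic_cell:
  assumes "0 \<le> x" "x < 1" "x \<in> unit_cell (of_int a, Rightward) (1 / 2 ^ n) j"
  shows "return_time vnk (unit_cell (of_int a, Rightward) (1 / 2 ^ n) j) x = enat (2 ^ n)"
proof -
  let ?A = "unit_cell (of_int a, Rightward) (1 / 2 ^ n) j"
  have mem: "y \<in> ?A \<longleftrightarrow> y \<in> {0..1} \<and> \<lfloor>2 ^ n * y\<rfloor> = j + a * 2 ^ n" for y
  proof -
    have "\<lfloor>grid_coord (of_int a, Rightward) (1 / 2 ^ n) y\<rfloor> = \<lfloor>2 ^ n * y - of_int (a * 2 ^ n)\<rfloor>"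
      by (simp add: algebra_simps)
    also have "\<dots> = \<lfloor>2 ^ n * y\<rfloor> - a * 2 ^ n" by (rule floor_diff_of_int)
    finally show ?thesis
      unfolding cell_in_def by (auto simp: mem_grid_cell_iff simp del: grid_coord.simps grid_cell.simps)
  qed
  have "(vnk ^^ m) x \<in> ?A \<longleftrightarrow> 2 ^ n dvd m" for m
    using assms vnk_iterate_bounds[OF assms(1,2), of m] vnk_iterate_same_cell_iff[OF assms(1,2), of n m]
    unfolding mem by auto
  then show ?thesis
    by (intro antisym return_time_le return_time_ge) (auto dest: dvd_imp_le)
qed

lemma emeasure_sum_positive_cells:
  assumes "0 < \<epsilon>"
  shows "(\<Sum>j\<in>positive_cells \<theta> \<epsilon>. emeasure unit_lebesgue (unit_cell \<theta> \<epsilon> j)) = 1"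
  unfolding unit_lebesgue.emeasure_eq_measure
  by (simp add: sum_ennreal sum_measure_positive_cells[OF assms])

lemma
  fixes a :: int and n :: nat
  defines "\<theta> \<equiv> (of_int a, Rightward)" and "\<epsilon> \<equiv> 1 / 2 ^ n"
  shows Upsilon_tau_dyadic: "Upsilon_tau unit_lebesgue vnk \<theta> \<epsilon> q = ennreal ((2 ^ n) powr (1 - q))"
    and Upsilon_log_sum_dyadic: "Upsilon_log_sum \<theta> \<epsilon> = ennreal (ln (2 ^ n))"
proof -
  have \<epsilon>: "0 < \<epsilon>" by (simp add: \<epsilon>_def)
  have cell: "(\<integral>\<^sup>+x\<in>unit_cell \<theta> \<epsilon> j. g x \<partial>unit_lebesgue) = c * emeasure unit_lebesgue (unit_cell \<theta> \<epsilon> j)"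
    if "\<And>x. return_time vnk (unit_cell \<theta> \<epsilon> j) x = enat (2 ^ n) \<Longrightarrow> g x = c" for g c j
  proof -
    have "(\<integral>\<^sup>+x\<in>unit_cell \<theta> \<epsilon> j. g x \<partial>unit_lebesgue) = (\<integral>\<^sup>+x\<in>unit_cell \<theta> \<epsilon> j. c \<partial>unit_lebesgue)"
      by (rule nn_integral_cong_AE) (use AE_unit_lebesgue in eventually_elim,
        use return_time_dyadic_cell[of _ a n j] that in \<open>auto simp: indicator_def \<theta>_def \<epsilon>_def\<close>)
    then show ?thesis by (simp add: nn_integral_cmult_indicator unit_cell_sets)
  qed
  show "Upsilon_tau unit_lebesgue vnk \<theta> \<epsilon> q = ennreal ((2 ^ n) powr (1 - q))"
    unfolding Upsilon_tau_unit[OF \<epsilon>]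
    by (subst cell[where c = "ennreal ((2 ^ n) powr (1 - q))"])
      (auto simp: return_pow_eq emeasure_sum_positive_cells[OF \<epsilon>] simp flip: sum_distrib_left)
  show "Upsilon_log_sum \<theta> \<epsilon> = ennreal (ln (2 ^ n))"
    unfolding Upsilon_log_sum_def infsum_unit_cells[OF \<epsilon>]
    by (subst cell[where c = "ennreal (ln (2 ^ n))"])
      (auto simp: return_log_eq emeasure_sum_positive_cells[OF \<epsilon>] simp flip: sum_distrib_left)
qed

lemma Upsilon_dim_quotient_dyadic:
  assumes "0 < n"
  shows "Upsilon_dim_quotient (of_int a, Rightward) q (1 / 2 ^ n) = 1"
proof -
  have \<epsilon>: "0 < 1 / (2::real) ^ n" "1 / 2 ^ n < (1::real)" using assms by auto
  have "Upsilon_dim_quotient (of_int a, Rightward) q (1 / 2 ^ n) \<le> ereal (ln (2 ^ n) / - ln (1 / 2 ^ n))"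
    by (rule dim_quotient_le_base[OF \<epsilon> _ Upsilon_tau_log_unit])
      (simp_all add: Upsilon_tau_dyadic Upsilon_log_sum_dyadic)
  moreover have "ereal (ln (2 ^ n) / - ln (1 / 2 ^ n)) \<le> Upsilon_dim_quotient (of_int a, Rightward) q (1 / 2 ^ n)"
    by (rule dim_quotient_ge_base[OF \<epsilon> _ Upsilon_tau_log_unit])
      (simp_all add: Upsilon_tau_dyadic Upsilon_log_sum_dyadic)
  moreover have "ln (2 ^ n) / - ln (1 / 2 ^ n) = (1::real)"
    using assms by (simp add: ln_div ln_realpow)
  ultimately show ?thesis by (simp add: one_ereal_def)
qed

lemma filterlim_dyadic: "filterlim (\<lambda>n. 1 / 2 ^ Suc n) (at_right (0::real)) sequentially"
  by real_asymp

lemma Delta_tau_upper_dyadic: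
  assumes "0 \<le> q"
  shows "Delta_tau_upper unit_lebesgue vnk (of_int a, Rightward) q = 1"
proof (rule antisym)
  let ?\<theta> = "(of_int a, Rightward)"
  have "Limsup (at_right 0) (Upsilon_dim_quotient ?\<theta> q) \<le> Limsup (at_right 0) (\<lambda>\<epsilon>. ereal (ln (3 / \<epsilon>) / - ln \<epsilon>))"
    using Upsilon_dim_quotient_le assms by (intro Limsup_mono eventually_at_right_unit[of 1]) auto
  also have "((\<lambda>\<epsilon>. ln (3 / \<epsilon>) / - ln \<epsilon>) \<longlongrightarrow> (1::real)) (at_right 0)"
    by real_asymp
  then have "Limsup (at_right 0) (\<lambda>\<epsilon>. ereal (ln (3 / \<epsilon>) / - ln \<epsilon>)) = ereal 1"
    by (intro lim_imp_Limsup tendsto_ereal) auto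
  finally show "Delta_tau_upper unit_lebesgue vnk ?\<theta> q \<le> 1"
    by (simp add: Delta_tau_upper_def upper_dim_def one_ereal_def)
  have "(\<lambda>n. Upsilon_dim_quotient ?\<theta> q (1 / 2 ^ Suc n)) \<longlonglongrightarrow> 1"
    by (simp only: Upsilon_dim_quotient_dyadic[OF zero_less_Suc]) simp
  from le_Limsup_sequence[OF filterlim_dyadic this]
  show "1 \<le> Delta_tau_upper unit_lebesgue vnk ?\<theta> q"
    by (simp add: Delta_tau_upper_def upper_dim_def)
qed

lemma Delta_tau_lower_dyadic:
  assumes "q \<le> 0"
  shows "Delta_tau_lower unit_lebesgue vnk (of_int a, Rightward) q = 1"
proof (rule antisym)
  let ?\<theta> = "(of_int a, Rightward)"
  have "(\<lambda>n. Upsilon_dim_quotient ?\<theta> q (1 / 2 ^ Suc n)) \<longlonglongrightarrow> 1"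
    by (simp only: Upsilon_dim_quotient_dyadic[OF zero_less_Suc]) simp
  from Liminf_le_sequence[OF filterlim_dyadic this]
  show "Delta_tau_lower unit_lebesgue vnk ?\<theta> q \<le> 1"
    by (simp add: Delta_tau_lower_def lower_dim_def)
  show "1 \<le> Delta_tau_lower unit_lebesgue vnk ?\<theta> q"
    unfolding Delta_tau_lower_def lower_dim_def
    using Upsilon_dim_quotient_ge assms by (intro Liminf_bounded eventually_at_right_unit[of 1]) auto
qed

section \<open>Exponentially small cells and infinite dimensions for negative exponents\<close>

lemma grid_line_cells:
  fixes i :: int
  assumes "0 < \<epsilon>"
  obtains j where "{a + of_int i * \<epsilon> <..< a + (of_int i + 1) * \<epsilon>} \<subseteq> grid_cell (a, d) \<epsilon> j"
    "grid_cell (a, d) \<epsilon> j \<subseteq> {a + of_int i * \<epsilon> .. a + (of_int i + 1) * \<epsilon>}"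
proof (cases d)
  case Rightward
  then show ?thesis by (intro that[of i]) auto
next
  case Leftward
  then show ?thesis by (intro that[of "- i - 1"]) (auto simp: algebra_simps)
qed

lemma measure_between_interval:
  assumes "A \<in> sets unit_lebesgue" "{u<..<v} \<subseteq> A" "A \<subseteq> {u..v}" "u \<le> v"
  shows "measure unit_lebesgue A = v - u"
proof -
  have A: "A \<in> sets borel" "A \<subseteq> {0..1}" using assms(1) by (auto simp: sets_unit_lebesgue)
  have "emeasure lborel A = ennreal (v - u)"
  proof (rule antisym)
    show "emeasure lborel A \<le> ennreal (v - u)"
      using emeasure_mono[OF assms(3), of lborel] assms(4) by simp
    show "ennreal (v - u) \<le> emeasure lborel A"
      using emeasure_mono[OF assms(2), of lborel] assms(4) A by simp
  qed
  then show ?thesis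
    using assms(4) A by (simp add: measure_def emeasure_unit_lebesgue)
qed

text \<open>For \<open>\<epsilon> = \<bar>c\<bar> / k\<close> the point \<open>a + c\<close> lies on the grid. Here it is at distance \<open>\<delta>\<close> from an
  endpoint of the unit interval, so the grid cuts off a cell of measure \<open>\<delta>\<close> there.\<close>

lemma tiny_edge_cell:
  assumes "0 < \<delta>" "\<delta> \<le> \<bar>c\<bar> / real k" "0 < k" "\<delta> \<le> 1" "a + c = \<delta> \<or> a + c = 1 - \<delta>"
  obtains j where "measure unit_lebesgue (unit_cell (a, d) (\<bar>c\<bar> / real k) j) = \<delta>"
proof -
  define \<epsilon> where "\<epsilon> = \<bar>c\<bar> / real k"
  have \<epsilon>: "0 < \<epsilon>" "\<delta> \<le> \<epsilon>" using assms(1,2) by (simp_all add: \<epsilon>_def)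
  \<comment> \<open>The signed number of steps from the origin \<open>a\<close> to the grid line at
    \<open>a + c\<close>. The small cell lies to the left of this line near 0 and to the right of it
    near 1; as \<open>\<delta> \<le> \<epsilon>\<close>, it reaches the end of the unit
    interval.\<close>
  define l :: int where "l = (if 0 \<le> c then int k else - int k)"
  have l: "of_int l * \<epsilon> = c" using assms(3) by (auto simp: l_def \<epsilon>_def)
  from assms(5) show ?thesis
  proof
    assume ac: "a + c = \<delta>"
    obtain j where "{a + of_int (l - 1) * \<epsilon> <..< a + (of_int (l - 1) + 1) * \<epsilon>} \<subseteq> grid_cell (a, d) \<epsilon> j"
      "grid_cell (a, d) \<epsilon> j \<subseteq> {a + of_int (l - 1) * \<epsilon> .. a + (of_int (l - 1) + 1) * \<epsilon>}"
      using grid_line_cells[OF \<epsilon>(1)] by blast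
    moreover have "a + of_int (l - 1) * \<epsilon> = \<delta> - \<epsilon>" "a + (of_int (l - 1) + 1) * \<epsilon> = \<delta>"
      using l ac by (auto simp: algebra_simps)
    ultimately have "{\<delta> - \<epsilon><..<\<delta>} \<subseteq> grid_cell (a, d) \<epsilon> j" "grid_cell (a, d) \<epsilon> j \<subseteq> {\<delta> - \<epsilon>..\<delta>}"
      by metis+
    moreover have "{0<..<\<delta>} \<subseteq> {\<delta> - \<epsilon><..<\<delta>} \<inter> {0..1}" "{\<delta> - \<epsilon>..\<delta>} \<inter> {0..1} \<subseteq> {0..\<delta>}"
      using \<epsilon> assms(4) by auto
    ultimately have "{0<..<\<delta>} \<subseteq> unit_cell (a, d) \<epsilon> j" "unit_cell (a, d) \<epsilon> j \<subseteq> {0..\<delta>}"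
      unfolding cell_in_def unit_lebesgue_space by blast+
    then have "measure unit_lebesgue (unit_cell (a, d) \<epsilon> j) = \<delta> - 0"
      using assms(1) by (intro measure_between_interval unit_cell_sets) auto
    then show ?thesis using that by (simp add: \<epsilon>_def)
  next
    assume ac: "a + c = 1 - \<delta>"
    obtain j where "{a + of_int l * \<epsilon> <..< a + (of_int l + 1) * \<epsilon>} \<subseteq> grid_cell (a, d) \<epsilon> j"
      "grid_cell (a, d) \<epsilon> j \<subseteq> {a + of_int l * \<epsilon> .. a + (of_int l + 1) * \<epsilon>}"
      using grid_line_cells[OF \<epsilon>(1)] by blast
    moreover have "a + of_int l * \<epsilon> = 1 - \<delta>" "a + (of_int l + 1) * \<epsilon> = 1 - \<delta> + \<epsilon>"
      using l ac by (auto simp: algebra_simps)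
    ultimately have "{1 - \<delta><..<1 - \<delta> + \<epsilon>} \<subseteq> grid_cell (a, d) \<epsilon> j" "grid_cell (a, d) \<epsilon> j \<subseteq> {1 - \<delta>..1 - \<delta> + \<epsilon>}"
      by metis+
    moreover have "{1 - \<delta><..<1} \<subseteq> {1 - \<delta><..<1 - \<delta> + \<epsilon>} \<inter> {0..1}" "{1 - \<delta>..1 - \<delta> + \<epsilon>} \<inter> {0..1} \<subseteq> {1 - \<delta>..1}"
      using \<epsilon> assms(4) by auto
    ultimately have "{1 - \<delta><..<1} \<subseteq> unit_cell (a, d) \<epsilon> j" "unit_cell (a, d) \<epsilon> j \<subseteq> {1 - \<delta>..1}"
      unfolding cell_in_def unit_lebesgue_space by blast+
    then have "measure unit_lebesgue (unit_cell (a, d) \<epsilon> j) = 1 - (1 - \<delta>)"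
      using assms(1) by (intro measure_between_interval unit_cell_sets) auto
    then show ?thesis using that by (simp add: \<epsilon>_def)
  qed
qed

text \<open>Jensen's inequality on one cell: with the tangent at the mean return time
  \<open>1 / \<delta>\<close>, the cell alone contributes at least \<open>\<delta> powr q\<close>,
  the same as its term in the sum of powers of measures.\<close>

lemma Upsilon_ge_cell:
  assumes "0 < \<epsilon>" "q < 0" "0 < \<delta>" "measure unit_lebesgue (unit_cell \<theta> \<epsilon> j) = \<delta>"
  shows "ennreal (\<delta> powr q) \<le> Upsilon_tau unit_lebesgue vnk \<theta> \<epsilon> q"
    and "ennreal (\<delta> powr q) \<le> Upsilon_mu unit_lebesgue \<theta> \<epsilon> q"
proof -
  have \<delta>: "emeasure unit_lebesgue (unit_cell \<theta> \<epsilon> j) = ennreal \<delta>"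
    using assms(4) by (simp add: unit_lebesgue.emeasure_eq_measure)
  then have j: "j \<in> positive_cells \<theta> \<epsilon>"
    using assms(3) by (simp add: positive_cells_def)
  then obtain u v where "u < v" "{u..v} \<subseteq> unit_cell \<theta> \<epsilon> j" by (rule unit_cell_interval)
  then have "ennreal (q * (1 / \<delta>) powr (1 - q) * \<delta> + (1 - q) * (1 / \<delta>) powr (- q))
      \<le> (\<integral>\<^sup>+x\<in>unit_cell \<theta> \<epsilon> j. return_pow vnk q (unit_cell \<theta> \<epsilon> j) x \<partial>unit_lebesgue)"
    using vnk_cell_pow_lower[OF unit_cell_sets, of u v \<theta> \<epsilon> j q "1 / \<delta>"] assms by simp
  also have "q * (1 / \<delta>) powr (1 - q) * \<delta> + (1 - q) * (1 / \<delta>) powr (- q) = \<delta> powr q"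
  proof -
    have inv: "(1 / \<delta>) powr x = \<delta> powr (- x)" for x
      using assms(3) by (simp add: powr_divide powr_minus_divide)
    have "\<delta> * \<delta> powr (- (1 - q)) = \<delta> powr q"
      using assms(3) powr_mult_base[of \<delta> "- (1 - q)"] by simp
    then have "q * \<delta> powr (- (1 - q)) * \<delta> = q * \<delta> powr q" by (metis mult.assoc mult.commute)
    then show ?thesis unfolding inv by (simp add: algebra_simps)
  qed
  also have "(\<integral>\<^sup>+x\<in>unit_cell \<theta> \<epsilon> j. return_pow vnk q (unit_cell \<theta> \<epsilon> j) x \<partial>unit_lebesgue) \<le> Upsilon_tau unit_lebesgue vnk \<theta> \<epsilon> q"
    unfolding Upsilon_tau_unit[OF assms(1)]
    using finite_positive_cells[OF assms(1)] j by (intro member_le_sum) auto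
  finally show "ennreal (\<delta> powr q) \<le> Upsilon_tau unit_lebesgue vnk \<theta> \<epsilon> q" .
  have "ennreal (\<delta> powr q) = epowr (emeasure unit_lebesgue (unit_cell \<theta> \<epsilon> j)) q"
    using assms(3) by (simp add: \<delta> epowr_ennreal)
  also have "\<dots> \<le> (\<Sum>j\<in>positive_cells \<theta> \<epsilon>. epowr (emeasure unit_lebesgue (unit_cell \<theta> \<epsilon> j)) q)"
    using finite_positive_cells[OF assms(1)] j by (intro member_le_sum) auto
  also have "\<dots> = Upsilon_mu unit_lebesgue \<theta> \<epsilon> q"
    unfolding Upsilon_mu_def positive_cells_def[symmetric]
    using finite_positive_cells[OF assms(1)] by simp
  finally show "ennreal (\<delta> powr q) \<le> Upsilon_mu unit_lebesgue \<theta> \<epsilon> q" .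
qed

text \<open>The grid line is aimed at the right end of the unit interval, or at the left end if the
  origin is 1. Then \<open>\<bar>c k\<bar>\<close> tends to \<open>D > 0\<close>, so the scale is of
  order \<open>1 / k\<close> while the cell has measure \<open>(1/2) ^ k\<close>.\<close>

lemma exists_tiny_cells:
  fixes a :: real
  obtains c :: "nat \<Rightarrow> real" and D where "0 < D" "\<And>k. \<bar>c k\<bar> \<le> D + 1"
    "eventually (\<lambda>k. D / 2 \<le> \<bar>c k\<bar>) sequentially"
    "eventually (\<lambda>k. \<exists>j. measure unit_lebesgue (unit_cell (a, d) (\<bar>c k\<bar> / real k) j) = (1/2) ^ k) sequentially"
proof -
  define c where "c k = (if a = 1 then (1/2) ^ k - a else 1 - (1/2) ^ k - a)" for k :: nat
  define D where "D = (if a = 1 then 1 else \<bar>1 - a\<bar>)"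
  have D: "0 < D" by (simp add: D_def)
  have pow: "(1/2 :: real) ^ k \<le> 1" "0 < (1/2 :: real) ^ k" for k :: nat
    by (auto simp: power_le_one)
  have c: "\<bar>c k\<bar> \<le> D + p \<and> D - p \<le> \<bar>c k\<bar> \<and> p \<le> 1" if "p = (1/2) ^ k" for k p
    using pow[of k] unfolding c_def D_def that[symmetric] by auto
  then have "\<bar>c k\<bar> \<le> D + 1" for k using c[OF refl, of k] by linarith
  moreover have half: "eventually (\<lambda>k. D / 2 \<le> \<bar>c k\<bar>) sequentially"
  proof -
    have "eventually (\<lambda>k. (1/2 :: real) ^ k < D / 2) sequentially"
      using D by real_asymp
    then show ?thesis
    proof eventually_elim
      case (elim k)
      then show ?case using c[OF refl, of k] by linarith
    qed
  qed
  moreover have "eventually (\<lambda>k. \<exists>j. measure unit_lebesgue (unit_cell (a, d) (\<bar>c k\<bar> / real k) j) = (1/2) ^ k) sequentially"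
  proof -
    have "eventually (\<lambda>k. (1/2 :: real) ^ k \<le> D / 2 / real k) sequentially"
      using D by real_asymp
    then show ?thesis using half eventually_gt_at_top[of 0]
    proof eventually_elim
      case (elim k)
      have "D / 2 / real k \<le> \<bar>c k\<bar> / real k" using elim by (intro divide_right_mono) auto
      then have "(1/2) ^ k \<le> \<bar>c k\<bar> / real k" using elim by linarith
      moreover have "a + c k = (1/2) ^ k \<or> a + c k = 1 - (1/2) ^ k" by (simp add: c_def)
      ultimately show ?case using tiny_edge_cell[of "(1/2) ^ k" "c k" k a d] pow[of k] elim by blast
    qed
  qed
  ultimately show ?thesis using that[OF D] by blast
qed

text \<open>Along the scales \<open>s k\<close> of order \<open>1 / k\<close> the logarithm of the
  partition function is at least \<open>- q * real k * ln 2\<close>, while the normalisation grows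
  only like the logarithm of \<open>k\<close>. Keeping \<open>Z\<close> abstract serves measures and
  return times alike.\<close>

lemma upper_dim_eq_infinity:
  assumes "q < 0"
    and Z: "\<And>\<epsilon> \<delta> j. 0 < \<epsilon> \<Longrightarrow> 0 < \<delta> \<Longrightarrow> measure unit_lebesgue (unit_cell \<theta> \<epsilon> j) = \<delta> \<Longrightarrow> ennreal (\<delta> powr q) \<le> Z \<epsilon> q"
  shows "upper_dim Z L q = \<infinity>"
proof -
  obtain a d where \<theta>: "\<theta> = (a, d)" by (cases \<theta>)
  obtain c :: "nat \<Rightarrow> real" and D where D: "0 < D" "\<And>k. \<bar>c k\<bar> \<le> D + 1"
    and half: "eventually (\<lambda>k. D / 2 \<le> \<bar>c k\<bar>) sequentially"
    and cell: "eventually (\<lambda>k. \<exists>j. measure unit_lebesgue (unit_cell (a, d) (\<bar>c k\<bar> / real k) j) = (1/2) ^ k) sequentially"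
    using exists_tiny_cells[of a d] by blast
  define s where "s k = \<bar>c k\<bar> / real k" for k
  have s_le: "s k \<le> (D + 1) / real k" for k
    unfolding s_def using D(2) by (intro divide_right_mono) auto
  have s_pos: "eventually (\<lambda>k. 0 < s k) sequentially"
    using half eventually_gt_at_top[of 0]
    by eventually_elim (use D(1) in \<open>auto simp: s_def intro!: divide_pos_pos\<close>)
  have "((\<lambda>k. (D + 1) / real k) \<longlongrightarrow> 0) sequentially" by real_asymp
  then have s_lim: "s \<longlonglongrightarrow> 0"
    by (rule tendsto_sandwich[of "\<lambda>_. 0" s sequentially "\<lambda>k. (D + 1) / real k", rotated 3])
      (use s_le in \<open>auto simp: s_def\<close>)
  have s: "filterlim s (at_right 0) sequentially"
    unfolding filterlim_at using s_lim s_pos by (auto elim: eventually_mono)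
  have bound: "filterlim (\<lambda>k. q / (q - 1) * (real k * ln 2 / ln (2 * real k / D))) at_top sequentially"
  proof (rule filterlim_tendsto_pos_mult_at_top[OF tendsto_const])
    show "0 < q / (q - 1)" using assms(1) by (simp add: divide_neg_neg)
    show "filterlim (\<lambda>k. real k * ln 2 / ln (2 * real k / D)) at_top sequentially"
      using D(1) by real_asymp
  qed
  have ge: "eventually (\<lambda>k. ereal (q / (q - 1) * (real k * ln 2 / ln (2 * real k / D))) \<le> dim_quotient Z L q (s k)) sequentially"
  proof -
    have "eventually (\<lambda>k. s k < 1) sequentially"
      using s_lim by (rule order_tendstoD) simp
    then show ?thesis using s_pos half cell eventually_gt_at_top[of 0]
    proof eventually_elim
      case (elim k)
      from elim obtain j where j: "measure unit_lebesgue (unit_cell \<theta> (s k) j) = (1/2) ^ k"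
        by (auto simp: s_def \<theta>)
      then have "ennreal (((1/2) ^ k) powr q) \<le> Z (s k) q"
        using elim by (intro Z) auto
      then have "ereal (ln (((1/2) ^ k) powr q) / ((q - 1) * ln (s k))) \<le> dim_quotient Z L q (s k)"
        using elim assms(1) by (intro dim_quotient_ge) auto
      moreover have "ln (((1/2) ^ k) powr q) / ((q - 1) * ln (s k)) = q / (q - 1) * (real k * ln 2 / - ln (s k))"
        by (simp add: ln_powr ln_realpow ln_div)
      moreover have "q / (q - 1) * (real k * ln 2 / ln (2 * real k / D)) \<le> q / (q - 1) * (real k * ln 2 / - ln (s k))"
      proof (intro mult_left_mono divide_left_mono)
        have "1 / s k \<le> 2 * real k / D" using elim D(1) by (simp add: s_def field_simps)
        then have "ln (1 / s k) \<le> ln (2 * real k / D)"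
          using elim D(1) by (subst ln_le_cancel_iff) auto
        then show *: "- ln (s k) \<le> ln (2 * real k / D)" using elim by (simp add: ln_div)
        have "0 < - ln (s k)" using elim by simp
        with * show "0 < ln (2 * real k / D) * - ln (s k)" by (intro mult_pos_pos) linarith+
        show "0 \<le> q / (q - 1)" using assms(1) by (simp add: divide_nonpos_nonpos)
      qed auto
      ultimately show ?case by (metis ereal_less_eq(3) order_trans)
    qed
  qed
  have "(\<lambda>k. dim_quotient Z L q (s k)) \<longlonglongrightarrow> \<infinity>"
  proof (subst tendsto_PInfty, intro allI)
    fix r
    from bound have "eventually (\<lambda>k. r < q / (q - 1) * (real k * ln 2 / ln (2 * real k / D))) sequentially"
      by (simp add: filterlim_at_top_dense)
    then show "eventually (\<lambda>k. ereal r < dim_quotient Z L q (s k)) sequentially"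
      using ge
    proof eventually_elim
      case (elim k)
      from elim(1) show ?case by (intro less_le_trans[OF _ elim(2)]) simp
    qed
  qed
  from le_Limsup_sequence[OF s this] show ?thesis
    by (simp add: upper_dim_def)
qed

theorem theorem4:
  shows "(\<forall>q::real.
            D_tau_upper unit_lebesgue vnk q = ereal (if q \<le> 2 then 1 else 1 / (q - 1)) \<and>
            D_tau_lower unit_lebesgue vnk q = ereal (if q \<le> 2 then 1 else 1 / (q - 1)))
       \<and> (\<forall>(\<theta>::grid) (q::real). q < 0 \<longrightarrow>
            Delta_tau_upper unit_lebesgue vnk \<theta> q = \<infinity> \<and>
            Delta_mu_upper unit_lebesgue \<theta> q = \<infinity>)
       \<and> infinite {\<theta>::grid.
            (\<forall>q\<ge>0. Delta_tau_upper unit_lebesgue vnk \<theta> q = 1) \<and>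
            (\<forall>q\<le>0. Delta_tau_lower unit_lebesgue vnk \<theta> q = 1)}"
proof (intro conjI allI impI)
  fix q :: real
  show "D_tau_upper unit_lebesgue vnk q = ereal (if q \<le> 2 then 1 else 1 / (q - 1))"
    "D_tau_lower unit_lebesgue vnk q = ereal (if q \<le> 2 then 1 else 1 / (q - 1))"
    by (rule D_tau_vnk)+
next
  fix \<theta> :: grid and q :: real assume "q < 0"
  then show "Delta_tau_upper unit_lebesgue vnk \<theta> q = \<infinity>" "Delta_mu_upper unit_lebesgue \<theta> q = \<infinity>"
    unfolding Delta_tau_upper_def Delta_mu_upper_def
    using Upsilon_ge_cell[where \<theta> = \<theta>] by (auto intro!: upper_dim_eq_infinity[where \<theta> = \<theta>])
next
  let ?G = "{\<theta>::grid. (\<forall>q\<ge>0. Delta_tau_upper unit_lebesgue vnk \<theta> q = 1) \<and>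
    (\<forall>q\<le>0. Delta_tau_lower unit_lebesgue vnk \<theta> q = 1)}"
  have "range (\<lambda>a::int. (real_of_int a, Rightward)) \<subseteq> ?G"
    using Delta_tau_upper_dyadic Delta_tau_lower_dyadic by blast
  \<comment> \<open>Grids with different integer origins agree at the scales
    \<open>1 / 2 ^ n\<close> but not at all scales.\<close>
  moreover have "infinite (range (\<lambda>a::int. (real_of_int a, Rightward)))"
    using infinite_UNIV_int by (subst finite_image_iff) (auto simp: inj_on_def)
  ultimately show "infinite ?G" using infinite_super by blast
qed

end
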